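(* Let $S\colon\mathbf{R}\rightrightarrows\mathbf{R}^n$ be a definable set-valued mapping having a closed graph, and let $\mathcal{U}$ be a bounded subset of $\mathbf{R}^n$. Then for any real $a\in\mathbf{R}$ there exist a number $b>a$ and a strictly increasing, continuous function $\Psi\colon[a,b)\to\mathbf{R}$ that is $C^1$-smooth on $(a,b)$, satisfies $\Psi(a)=a$, and is such that $$\left|D^*_c(S\circ\Psi)(r|x)\right|^+\le 1\qquad\text{for all } r\in(a,b)\text{ and all } x\in S(\Psi(r))\cap\mathcal{U}.$$
   Context: Fix an o-minimal structure expanding the real field; "definable" means definable in this structure (e.g. semi-algebraic). A set-valued mapping $S\colon I\rightrightarrows\mathbf{R}^n$ on an interval $I$ assigns to each $r\in I$ a (possibly empty) subset $S(r)\subset\mathbf{R}^n$; its graph is $\mathrm{gph}\,S=\{(r,x): r\in I,\ x\in S(r)\}$, and $S$ is definable if its graph is. $S\circ\Psi$ is the mapping $r\mapsto S(\Psi(r))$. Normal cones. For $Q\subset\mathbf{R}^k$ and $\bar x\in Q$: the Fréchet normal cone $\hat N_Q(\bar x)$ is the set of $v$ with $\langle v,x-\bar x\rangle\le o(\|x-\bar x\|)$ for $x\in Q$ (where $o(\|x-\bar x\|)/\|x-\bar x\|\to0$ as $x\to\bar x$ in $Q$); the limiting normal cone $N_Q(\bar x)$ is the set of limits $v=\lim v_i$ with $v_i\in\hat N_Q(x_i)$, $x_i\in Q$, $x_i\to\bar x$; the Clarke normal cone is $N^c_Q(\bar x)=\mathrm{cl}\,\mathrm{conv}\,N_Q(\bar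 x)$. For a set-valued mapping $G$ from (an interval in) $\mathbf{R}$ to $\mathbf{R}^n$ and $(r,x)\in\mathrm{gph}\,G$, the Clarke coderivative is $D^*_cG(r|x)(u)=\{v\in\mathbf{R}:(v,-u)\in N^c_{\mathrm{gph}\,G}(r,x)\}$ for $u\in\mathbf{R}^n$, and its outer norm is $|D^*_cG(r|x)|^+=\sup_{\|u\|\le1}\sup\{|v|:v\in D^*_cG(r|x)(u)\}\in[0,+\infty]$. *)

theory Defs
  imports "HOL-Analysis.Analysis"
begin

text \<open>O-minimal structures expanding the real field, following van den Dries.
  A point of \<open>R^m\<close> is a list of length \<open>m\<close>, and \<open>M m\<close> is the family of definable subsets of \<open>R^m\<close>.
  Since \<open>M 1\<close> is required to contain every finite union of intervals, all singletons are
  definable, i.e. definability is with real parameters.\<close>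

locale o_minimal_real_field =
  fixes M :: "nat \<Rightarrow> real list set set"
  assumes ambient: "A \<in> M m \<Longrightarrow> A \<subseteq> {xs. length xs = m}"
    and empty: "{} \<in> M m"
    and union: "A \<in> M m \<Longrightarrow> B \<in> M m \<Longrightarrow> A \<union> B \<in> M m"
    and complement: "A \<in> M m \<Longrightarrow> {xs. length xs = m} - A \<in> M m"
    and product_left: "A \<in> M m \<Longrightarrow> {x # xs | x xs. xs \<in> A} \<in> M (Suc m)"
    and product_right: "A \<in> M m \<Longrightarrow> {xs @ [x] | x xs. xs \<in> A} \<in> M (Suc m)"
    and diagonal: "m \<ge> 1 \<Longrightarrow> {xs. length xs = m \<and> hd xs = last xs} \<in> M m"
    and projection: "A \<in> M (Suc m) \<Longrightarrow> butlast ` A \<in> M m"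
    and order: "{[x, y] | x y. x < y} \<in> M 2"
    and addition: "{[x, y, x + y] | x y. True} \<in> M 3"
    and multiplication: "{[x, y, x * y] | x y. True} \<in> M 3"
    and o_minimal: "M 1 = {(\<lambda>x. [x]) ` (\<Union>\<I>) | \<I>. finite \<I> \<and> (\<forall>J\<in>\<I>. is_interval J)}"

text \<open>A subset of a Euclidean space is identified with a set of coordinate lists through an
  enumeration \<open>bs\<close> of the standard basis. The choice of enumeration is immaterial, because
  structures are closed under permutation of coordinates.\<close>

definition definable_set :: "(nat \<Rightarrow> real list set set) \<Rightarrow> 'a::euclidean_space set \<Rightarrow> bool" where
  "definable_set M X \<longleftrightarrow>
     (\<exists>bs. distinct bs \<and> set bs = Basis \<and> (\<lambda>x. map (\<lambda>b. x \<bullet> b) bs) ` X \<in> M DIM('a))"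

text \<open>A set-valued mapping on an interval \<open>I\<close> is a function into sets, of which only the
  values on \<open>I\<close> matter.\<close>

definition gph :: "real set \<Rightarrow> (real \<Rightarrow> 'a set) \<Rightarrow> (real \<times> 'a) set" where
  "gph I S = {(r, x). r \<in> I \<and> x \<in> S r}"

text \<open>The cones below are meaningful only at points of \<open>Q\<close>. In the first one, \<open>w\<close> is the
  term \<open>o(norm (x - xbar))\<close>.\<close>

definition frechet_normal_cone :: "'a::euclidean_space set \<Rightarrow> 'a \<Rightarrow> 'a set" where
  "frechet_normal_cone Q xbar =
     {v. \<exists>w :: 'a \<Rightarrow> real. (\<forall>x\<in>Q. v \<bullet> (x - xbar) \<le> w x) \<and>
           ((\<lambda>x. w x / norm (x - xbar)) \<longlongrightarrow> 0) (at xbar within Q)}"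

definition limiting_normal_cone :: "'a::euclidean_space set \<Rightarrow> 'a \<Rightarrow> 'a set" where
  "limiting_normal_cone Q xbar =
     {v. \<exists>x w. (\<forall>i::nat. x i \<in> Q \<and> w i \<in> frechet_normal_cone Q (x i)) \<and>
           x \<longlonglongrightarrow> xbar \<and> w \<longlonglongrightarrow> v}"

definition clarke_normal_cone :: "'a::euclidean_space set \<Rightarrow> 'a \<Rightarrow> 'a set" where
  "clarke_normal_cone Q xbar = closure (convex hull (limiting_normal_cone Q xbar))"

definition clarke_coderivative ::
  "real set \<Rightarrow> (real \<Rightarrow> 'a::euclidean_space set) \<Rightarrow> real \<Rightarrow> 'a \<Rightarrow> 'a \<Rightarrow> real set" where
  "clarke_coderivative I G r x u = {v. (v, - u) \<in> clarke_normal_cone (gph I G) (r, x)}"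

definition outer_norm :: "('a::euclidean_space \<Rightarrow> real set) \<Rightarrow> ennreal" where
  "outer_norm H = (SUP u\<in>{u. norm u \<le> 1}. SUP v\<in>H u. ennreal \<bar>v\<bar>)"

end

theory Submission
  imports Defs
begin

text \<open>Write \<open>Q\<close> for the graph of \<open>S\<close>. Along a definable curve \<open>x\<close> every limiting normal to \<open>Q\<close> at
  \<open>(r, x r)\<close> is orthogonal to \<open>(1, x' r)\<close>, except for finitely many \<open>r\<close>. Otherwise some interval of
  parameters \<open>r\<close> admits a fixed vector \<open>n\<close>, far from orthogonal to \<open>(1, x' r)\<close>, and definably chosen
  points \<open>p (r, \<delta>)\<close> of \<open>Q\<close> within \<open>\<delta>\<close> of \<open>(r, x r)\<close> with a Frechet normal near \<open>n\<close>. On a common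
  smaller interval, for all small \<open>\<delta>\<close>, the curves \<open>r \<mapsto> p (r, \<delta>)\<close> are differentiable with monotone
  coordinates. They move orthogonally to their normals, so \<open>n\<close> is almost orthogonal to their
  increments, and hence, for \<open>\<delta> \<rightarrow> 0\<close>, to those of the given curve.

  Let \<open>x r\<close> now be a point of \<open>S r\<close> in a ball around \<open>U\<close> at which the least norm \<open>\<nu> r\<close> of a \<open>w\<close> with
  \<open>(1, w)\<close> orthogonal to all limiting normals is almost as large as possible. Then \<open>\<nu> \<le> norm x'\<close>,
  and \<open>x'\<close> is integrable near \<open>a\<close>, because the coordinates of \<open>x\<close> are bounded and eventually
  monotone. So \<open>\<nu>\<close> is dominated by the derivative of a continuous increasing function, whose inverse
  serves as \<open>\<Psi>\<close>. Orthogonality to a fixed vector is a closed convex condition and therefore passes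
  from the limiting to the Clarke normal cone.\<close>

section \<open>Definable sets and maps in Euclidean spaces\<close>

text \<open>O-minimality acts through three facts: an infinite definable set of reals contains an
  interval; a definable property holds throughout some one-sided neighbourhood of a point or fails
  throughout one; a countable definable cover of an interval has a member that contains a
  subinterval. The obstacle is that a limiting normal at \<open>(r, x r)\<close> is a limit of
  Frechet normals at points off the curve, while a Frechet normal controls only curves through its
  own base point. Each nearby point is therefore moved along a curve of its own. The velocities of
  these curves need not converge as the distance shrinks, only their positions do, so orthogonality
  is integrated before the limit is taken. Monotone coordinates make the integral of the l1 norm of
  the velocity a linear function of the increment, which is what allows this. \<open>U\<close> need
  not be definable, but a ball containing it is, and the selections are made there. The summand 2 in
  \<open>h + 2\<close> outweighs the loss of 1 in an almost maximal choice and keeps the derivative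
  of \<open>\<Phi>\<close> positive.\<close>

context o_minimal_real_field
begin

section \<open>Boolean operations and coordinate substitutions for sets of lists\<close>

lemma lists_of_length: "{xs. length xs = m} \<in> M m"
  using complement[OF empty] by simp

lemma intersection: "A \<in> M m \<Longrightarrow> B \<in> M m \<Longrightarrow> A \<inter> B \<in> M m"
proof -
  assume A: "A \<in> M m" and B: "B \<in> M m"
  let ?L = "{xs. length xs = m}"
  have "A \<inter> B = ?L - ((?L - A) \<union> (?L - B))"
    using ambient[OF A] ambient[OF B] by blast
  then show ?thesis
    using complement[OF union[OF complement[OF A] complement[OF B]]] by simp
qed

lemma finite_intersection:
  assumes "finite I" "\<And>i. i \<in> I \<Longrightarrow> {xs. length xs = m \<and> P i xs} \<in> M m"
  shows "{xs. length xs = m \<and> (\<forall>i\<in>I. P i xs)} \<in> M m"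
  using assms
proof (induction I rule: finite_induct)
  case empty
  then show ?case using lists_of_length by simp
next
  case (insert i I)
  have "{xs. length xs = m \<and> (\<forall>i\<in>insert i I. P i xs)} =
    {xs. length xs = m \<and> P i xs} \<inter> {xs. length xs = m \<and> (\<forall>i\<in>I. P i xs)}" by auto
  then show ?case using insert intersection by simp
qed

lemma pad_left: "A \<in> M m \<Longrightarrow> {ys @ xs | ys xs. length ys = k \<and> xs \<in> A} \<in> M (k + m)"
proof (induction k)
  case 0
  then show ?case by simp
next
  case (Suc k)
  have "{ys @ xs | ys xs. length ys = Suc k \<and> xs \<in> A} =
      {x # zs | x zs. zs \<in> {ys @ xs | ys xs. length ys = k \<and> xs \<in> A}}" (is "?L = ?R")
  proof
    show "?L \<subseteq> ?R"
    proof
      fix z assume "z \<in> ?L"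
      then obtain ys xs where z: "z = ys @ xs" "xs \<in> A" "length ys = Suc k" by auto
      then obtain y u where "ys = y # u" "length u = k"
        by (auto simp: length_Suc_conv)
      then show "z \<in> ?R" using z by auto
    qed
    show "?R \<subseteq> ?L"
    proof
      fix z assume "z \<in> ?R"
      then obtain xs ys u where z: "z = u # (ys @ xs)" "xs \<in> A" "length ys = k" by blast
      then have "z = (u # ys) @ xs" "length (u # ys) = Suc k" by auto
      then show "z \<in> ?L" using z by blast
    qed
  qed
  then show ?case using product_left[OF Suc.IH] Suc.prems by simp
qed

lemma pad_right: "A \<in> M m \<Longrightarrow> {xs @ ys | xs ys. xs \<in> A \<and> length ys = k} \<in> M (m + k)"
proof (induction k)
  case 0
  then show ?case by simp
next
  case (Suc k)
  have "{xs @ ys | xs ys. xs \<in> A \<and> length ys = Suc k} =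
      {zs @ [x] | x zs. zs \<in> {xs @ ys | xs ys. xs \<in> A \<and> length ys = k}}" (is "?L = ?R")
  proof
    show "?L \<subseteq> ?R"
    proof
      fix z assume "z \<in> ?L"
      then obtain xs ys where z: "z = xs @ ys" "xs \<in> A" "length ys = Suc k" by auto
      then obtain y u where "ys = y @ [u]" "length y = k"
        by (auto simp: length_Suc_conv_rev)
      then show "z \<in> ?R" using z by auto
    qed
    show "?R \<subseteq> ?L"
    proof
      fix z assume "z \<in> ?R"
      then obtain xs ys u where z: "z = (xs @ ys) @ [u]" "xs \<in> A" "length ys = k" by blast
      then have "z = xs @ (ys @ [u])" "length (ys @ [u]) = Suc k" by auto
      then show "z \<in> ?L" using z by blast
    qed
  qed
  then show ?case using product_right[OF Suc.IH] Suc.prems by simp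
qed

lemma take_projection: "A \<in> M (m + k) \<Longrightarrow> take m ` A \<in> M m"
proof (induction k arbitrary: A)
  case 0
  have "take m ` A = A"
    using ambient[OF 0] by (force simp: image_def)
  then show ?case using 0 by simp
next
  case (Suc k)
  then have "butlast ` A \<in> M (m + k)" using projection by simp
  then have "take m ` butlast ` A \<in> M m" by (rule Suc.IH)
  moreover have "take m (butlast xs) = take m xs" if "xs \<in> A" for xs
    using ambient[OF Suc.prems] that by (auto simp: butlast_conv_take min_def)
  ultimately show ?case by (simp add: image_image cong: image_cong)
qed

text \<open>The diagonal axiom compares only the first and the last entry of a list. It is applied
  to the window of length \<open>j - i + 1\<close> that starts at \<open>i\<close>, which is then
  padded on both sides.\<close>

lemma coordinate_equality_less:
  assumes "i < j" "j < N"
  shows "{xs. length xs = N \<and> xs ! i = xs ! j} \<in> M N"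
proof -
  let ?D = "{xs::real list. length xs = j - i + 1 \<and> hd xs = last xs}"
  have "?D \<in> M (j - i + 1)" by (rule diagonal) simp
  from pad_right[OF pad_left[OF this, of i], of "N - j - 1"]
  have M: "{xs @ ys | xs ys. xs \<in> {ys @ xs | ys xs. length ys = i \<and> xs \<in> ?D} \<and> length ys = N - j - 1} \<in> M N"
    using assms by simp
  have "{xs @ ys | xs ys. xs \<in> {ys @ xs | ys xs. length ys = i \<and> xs \<in> ?D} \<and> length ys = N - j - 1}
     = {xs. length xs = N \<and> xs ! i = xs ! j}" (is "?L = ?R")
  proof
    show "?L \<subseteq> ?R"
    proof
      fix z assume "z \<in> ?L"
      then obtain u v w where z: "z = (u @ v) @ w" "length u = i" "v \<in> ?D" "length w = N - j - 1"
        by blast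
      then have "v \<noteq> []" by auto
      then have "z ! i = hd v" "z ! j = last v"
        using z assms by (auto simp: nth_append hd_conv_nth last_conv_nth)
      then show "z \<in> ?R" using z assms by auto
    qed
    show "?R \<subseteq> ?L"
    proof
      fix z assume z: "z \<in> ?R"
      let ?u = "take i z" and ?v = "take (j - i + 1) (drop i z)" and ?w = "drop (j + 1) z"
      have v: "?v \<noteq> []" using z assms by auto
      have eq: "z = (?u @ ?v) @ ?w"
      proof -
        have "?v @ ?w = drop i z"
          using assms append_take_drop_id[of "j - i + 1" "drop i z"] by (simp add: add.commute)
        then show ?thesis by simp
      qed
      have "hd ?v = z ! i"
        using z assms v by (subst hd_conv_nth) auto
      moreover have "last ?v = z ! j"
        using z assms v by (subst last_conv_nth) auto
      ultimately have "?v \<in> ?D" using z assms by auto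
      moreover have "length ?u = i" "length ?w = N - j - 1" using z assms by auto
      ultimately show "z \<in> ?L" using eq by blast
    qed
  qed
  then show ?thesis using M by simp
qed

lemma coordinate_equality:
  assumes "i < N" "j < N"
  shows "{xs. length xs = N \<and> xs ! i = xs ! j} \<in> M N"
proof -
  consider "i < j" | "i = j" | "j < i" by linarith
  then show ?thesis
  proof cases
    case 3
    then show ?thesis using coordinate_equality_less[OF 3 assms(1)] by (simp add: eq_commute)
  qed (use coordinate_equality_less assms lists_of_length in auto)
qed

text \<open>The substituted values are appended as \<open>m\<close> further entries, tied to their
  sources by coordinate equalities, and projected away again. This covers permuting, repeating and
  adding dummy variables at once.\<close>

lemma coordinate_substitution:
  assumes A: "A \<in> M m" and f: "\<And>i. i < m \<Longrightarrow> f i < k"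
  shows "{xs. length xs = k \<and> map (\<lambda>i. xs ! f i) [0..<m] \<in> A} \<in> M k"
proof -
  let ?G = "{xs @ ys | xs ys. length xs = k \<and> ys \<in> A} \<inter>
      {zs. length zs = k + m \<and> (\<forall>i\<in>{..<m}. zs ! f i = zs ! (k + i))}"
  have "?G \<in> M (k + m)"
  proof (intro intersection pad_left[OF A] finite_intersection coordinate_equality)
    fix i assume "i \<in> {..<m}"
    then show "f i < k + m" "k + i < k + m" using f[of i] by auto
  qed simp
  then have "take k ` ?G \<in> M k" by (rule take_projection)
  also have "take k ` ?G = {xs. length xs = k \<and> map (\<lambda>i. xs ! f i) [0..<m] \<in> A}" (is "?L = ?R")
  proof
    show "?L \<subseteq> ?R"
    proof
      fix z assume "z \<in> ?L"
      then obtain xs ys where *: "length xs = k" "ys \<in> A" "z = take k (xs @ ys)"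
          "\<forall>i\<in>{..<m}. (xs @ ys) ! f i = (xs @ ys) ! (k + i)"
        by blast
      then have [simp]: "z = xs" "length ys = m" using ambient[OF A] by auto
      have "map (\<lambda>i. xs ! f i) [0..<m] = ys"
        using * f by (intro nth_equalityI) (auto simp: nth_append)
      then show "z \<in> ?R" using * by auto
    qed
    show "?R \<subseteq> ?L"
    proof
      fix z assume z: "z \<in> ?R"
      let ?zs = "z @ map (\<lambda>i. z ! f i) [0..<m]"
      have "?zs \<in> ?G" using z f by (auto simp: nth_append)
      moreover have "z = take k ?zs" using z by auto
      ultimately show "z \<in> ?L" by blast
    qed
  qed
  finally show ?thesis .
qed

end

section \<open>Points of a Euclidean space as coordinate lists\<close>

abbreviation coordinates :: "'a::euclidean_space list \<Rightarrow> 'a \<Rightarrow> real list" where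
  "coordinates bs x \<equiv> map (\<lambda>b. x \<bullet> b) bs"

lemma inj_coordinates: "set bs = Basis \<Longrightarrow> inj (coordinates bs)"
  by (rule injI) (auto intro: euclidean_eqI)

lemma length_basis_enumeration:
  fixes bs :: "'a::euclidean_space list"
  shows "distinct bs \<Longrightarrow> set bs = Basis \<Longrightarrow> length bs = DIM('a)"
  using distinct_card by fastforce

lemma surj_coordinates:
  fixes bs :: "'a::euclidean_space list"
  assumes bs: "distinct bs" "set bs = Basis" and xs: "length xs = DIM('a)"
  obtains x where "coordinates bs x = xs"
proof
  have l: "length xs = length bs" using length_basis_enumeration[OF bs] xs by simp
  let ?i = "\<lambda>b. THE i. i < length bs \<and> bs ! i = b"
  let ?x = "\<Sum>b\<in>Basis. (xs ! ?i b) *\<^sub>R b"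
  have "?i (bs ! j) = j" if "j < length bs" for j
    using that bs(1) by (auto simp: nth_eq_iff_index_eq)
  moreover have "?x \<bullet> bs ! j = xs ! ?i (bs ! j)" if "j < length bs" for j
    using nth_mem[OF that] bs(2) by (simp add: inner_sum_left_Basis)
  ultimately show "coordinates bs ?x = xs"
    using l by (intro nth_equalityI) auto
qed

text \<open>Substitutions of variables.\<close>

definition coordinate_map :: "('a::euclidean_space \<Rightarrow> 'b::euclidean_space) \<Rightarrow> bool" where
  "coordinate_map p \<longleftrightarrow> (\<forall>c\<in>Basis. \<exists>b\<in>Basis. \<forall>x. p x \<bullet> c = x \<bullet> b)"

lemma coordinate_map_id: "coordinate_map (\<lambda>x. x)"
  by (auto simp: coordinate_map_def)

lemma coordinate_map_fst: "coordinate_map p \<Longrightarrow> coordinate_map (\<lambda>x. fst (p x))"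
  unfolding coordinate_map_def
proof
  fix c :: 'b
  assume p: "\<forall>c\<in>Basis. \<exists>b\<in>Basis. \<forall>x. p x \<bullet> c = x \<bullet> b" and "c \<in> Basis"
  then have "(c, 0) \<in> Basis" by (simp add: Basis_prod_def)
  from bspec[OF p this] show "\<exists>b\<in>Basis. \<forall>x. fst (p x) \<bullet> c = x \<bullet> b" by (simp add: inner_prod_def)
qed

lemma coordinate_map_snd: "coordinate_map p \<Longrightarrow> coordinate_map (\<lambda>x. snd (p x))"
  unfolding coordinate_map_def
proof
  fix c :: 'c
  assume p: "\<forall>c\<in>Basis. \<exists>b\<in>Basis. \<forall>x. p x \<bullet> c = x \<bullet> b" and "c \<in> Basis"
  then have "(0, c) \<in> Basis" by (simp add: Basis_prod_def)
  from bspec[OF p this] show "\<exists>b\<in>Basis. \<forall>x. snd (p x) \<bullet> c = x \<bullet> b" by (simp add: inner_prod_def)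
qed

lemma coordinate_map_Pair:
  "coordinate_map p \<Longrightarrow> coordinate_map q \<Longrightarrow> coordinate_map (\<lambda>x. (p x, q x))"
  unfolding coordinate_map_def by (auto simp: Basis_prod_def)

lemma coordinate_map_inner:
  "coordinate_map p \<Longrightarrow> c \<in> Basis \<Longrightarrow> coordinate_map (\<lambda>x. p x \<bullet> c)"
  unfolding coordinate_map_def by auto

lemma coordinate_map_comp:
  "coordinate_map p \<Longrightarrow> coordinate_map q \<Longrightarrow> coordinate_map (\<lambda>x. q (p x))"
  unfolding coordinate_map_def by metis

lemmas coordinate_map_intros =
  coordinate_map_id coordinate_map_fst coordinate_map_snd coordinate_map_Pair coordinate_map_inner

context o_minimal_real_field
begin

lemma coordinates_vimage:
  fixes p :: "'a::euclidean_space \<Rightarrow> 'b::euclidean_space"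
  assumes p: "coordinate_map p"
    and bs: "distinct bs" "set bs = Basis" and cs: "distinct cs" "set cs = Basis"
    and X: "coordinates cs ` X \<in> M DIM('b)"
  shows "coordinates bs ` (p -` X) \<in> M DIM('a)"
proof -
  note lbs = length_basis_enumeration[OF bs] and lcs = length_basis_enumeration[OF cs]
  have "\<exists>j < DIM('a). \<forall>x. p x \<bullet> (cs ! i) = x \<bullet> (bs ! j)" if "i < DIM('b)" for i
  proof -
    have "cs ! i \<in> Basis" using that cs(2) lcs nth_mem by metis
    then obtain b where "b \<in> Basis" "\<forall>x. p x \<bullet> (cs ! i) = x \<bullet> b"
      using p unfolding coordinate_map_def by blast
    then show ?thesis using bs(2) lbs by (metis in_set_conv_nth)
  qed
  then obtain f where f: "\<And>i. i < DIM('b) \<Longrightarrow> f i < DIM('a)"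
      "\<And>i x. i < DIM('b) \<Longrightarrow> p x \<bullet> (cs ! i) = x \<bullet> (bs ! f i)"
    by metis
  have eq: "map (\<lambda>i. coordinates bs x ! f i) [0..<DIM('b)] = coordinates cs (p x)" for x
    using f lbs lcs by (intro nth_equalityI) auto
  have "coordinates bs ` (p -` X)
      = {xs. length xs = DIM('a) \<and> map (\<lambda>i. xs ! f i) [0..<DIM('b)] \<in> coordinates cs ` X}"
    (is "?L = ?R")
  proof
    show "?L \<subseteq> ?R" using eq lbs by auto
    show "?R \<subseteq> ?L"
    proof
      fix xs assume xs: "xs \<in> ?R"
      then obtain x where x: "xs = coordinates bs x" using surj_coordinates[OF bs] by blast
      then have "coordinates cs (p x) \<in> coordinates cs ` X" using xs eq by simp
      then have "p x \<in> X" using inj_image_mem_iff[OF inj_coordinates[OF cs(2)]] by blast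
      then show "xs \<in> ?L" using x by auto
    qed
  qed
  then show ?thesis using coordinate_substitution[OF X f(1)] by simp
qed

abbreviation definable :: "'a::euclidean_space set \<Rightarrow> bool" where
  "definable X \<equiv> definable_set M X"

text \<open>Both enumerations in \<open>coordinates_vimage\<close> are arbitrary, so with the
  identity as \<open>p\<close> it transports definability from the enumeration hidden in
  \<open>definable_set\<close> to any given one.\<close>

lemma definable_iff:
  fixes bs :: "'a::euclidean_space list"
  assumes "distinct bs" "set bs = Basis"
  shows "definable X \<longleftrightarrow> coordinates bs ` X \<in> M DIM('a)"
  using coordinates_vimage[OF coordinate_map_id assms] assms
  unfolding definable_set_def vimage_ident by blast

lemma basis_enumeration:
  obtains bs :: "'a::euclidean_space list" where "distinct bs" "set bs = Basis"
  using finite_distinct_list[OF finite_Basis] by metis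

lemma definable_vimage_coordinate_map:
  fixes p :: "'a::euclidean_space \<Rightarrow> 'b::euclidean_space"
  assumes p: "coordinate_map p" and X: "definable X"
  shows "definable {x. p x \<in> X}"
proof -
  obtain bs :: "'a list" where bs: "distinct bs" "set bs = Basis" by (rule basis_enumeration)
  obtain cs :: "'b list" where cs: "distinct cs" "set cs = Basis" by (rule basis_enumeration)
  show ?thesis
    using coordinates_vimage[OF p bs cs] X by (simp add: definable_iff[OF bs] definable_iff[OF cs] vimage_def)
qed

lemma definable_Compl:
  fixes X :: "'a::euclidean_space set"
  assumes "definable X" shows "definable (- X)"
proof -
  obtain bs :: "'a list" where bs: "distinct bs" "set bs = Basis" by (rule basis_enumeration)
  have "coordinates bs ` (- X) = {xs. length xs = DIM('a)} - coordinates bs ` X"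
  proof -
    have "range (coordinates bs) = {xs. length xs = DIM('a)}"
      using length_basis_enumeration[OF bs] surj_coordinates[OF bs] by (auto simp: image_iff) metis
    then show ?thesis using image_set_diff[OF inj_coordinates[OF bs(2)], of UNIV X] by (simp add: Compl_eq_Diff_UNIV)
  qed
  then show ?thesis using assms complement by (simp add: definable_iff[OF bs])
qed

lemma definable_Un:
  fixes X :: "'a::euclidean_space set"
  assumes "definable X" "definable Y" shows "definable (X \<union> Y)"
proof -
  obtain bs :: "'a list" where bs: "distinct bs" "set bs = Basis" by (rule basis_enumeration)
  show ?thesis using assms union by (simp add: definable_iff[OF bs] image_Un)
qed

lemma definable_fst_image:
  fixes X :: "('a::euclidean_space \<times> 'b::euclidean_space) set"
  assumes "definable X" shows "definable (fst ` X)"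
proof -
  obtain bs :: "'a list" where bs: "distinct bs" "set bs = Basis" by (rule basis_enumeration)
  obtain cs :: "'b list" where cs: "distinct cs" "set cs = Basis" by (rule basis_enumeration)
  \<comment> \<open>With the basis vectors of the first factor listed first, \<open>fst\<close>
    becomes \<open>take\<close> on coordinate lists.\<close>
  let ?ds = "map (\<lambda>b. (b, 0::'b)) bs @ map (\<lambda>c. (0::'a, c)) cs"
  have ds: "distinct ?ds" "set ?ds = Basis"
    using bs cs by (auto simp: distinct_map inj_on_def Basis_prod_def)
  have "coordinates bs ` fst ` X = take DIM('a) ` coordinates ?ds ` X"
    using length_basis_enumeration[OF bs]
    by (auto simp: image_image inner_prod_def o_def intro!: image_cong)
  then show ?thesis
    using assms take_projection by (simp add: definable_iff[OF bs] definable_iff[OF ds])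
qed

section \<open>Connectives and quantifiers\<close>

lemma definable_not: "definable {x. P x} \<Longrightarrow> definable {x. \<not> P x}"
  using definable_Compl[of "{x. P x}"] by (simp add: Collect_neg_eq)

lemma definable_disj: "definable {x. P x} \<Longrightarrow> definable {x. Q x} \<Longrightarrow> definable {x. P x \<or> Q x}"
  using definable_Un[of "{x. P x}" "{x. Q x}"] by (simp add: Collect_disj_eq)

lemma definable_conj: "definable {x. P x} \<Longrightarrow> definable {x. Q x} \<Longrightarrow> definable {x. P x \<and> Q x}"
  using definable_not[OF definable_disj[OF definable_not definable_not], of P Q] by simp

lemma definable_imp: "definable {x. P x} \<Longrightarrow> definable {x. Q x} \<Longrightarrow> definable {x. P x \<longrightarrow> Q x}"
  unfolding imp_conv_disj by (intro definable_disj definable_not)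

text \<open>In the quantifier rules the free variables are packed into the first component of a pair and
  the bound variable into the second.\<close>

lemma definable_ex:
  assumes "definable {z::'a::euclidean_space \<times> 'b::euclidean_space. P (fst z) (snd z)}"
  shows "definable {x. \<exists>y. P x y}"
proof -
  have "{x. \<exists>y. P x y} = fst ` {z. P (fst z) (snd z)}" by (force simp: image_iff)
  then show ?thesis using definable_fst_image[OF assms] by simp
qed

lemma definable_all:
  assumes "definable {z::'a::euclidean_space \<times> 'b::euclidean_space. P (fst z) (snd z)}"
  shows "definable {x. \<forall>y. P x y}"
  using definable_not[OF definable_ex[OF definable_not[OF assms]]] by simp

text \<open>The one place where the o-minimality axiom itself enters; everything later about
  definable sets of reals is drawn from this normal form.\<close>

lemma definable_real_iff:
  fixes A :: "real set"
  shows "definable A \<longleftrightarrow> (\<exists>\<I>. finite \<I> \<and> (\<forall>J\<in>\<I>. is_interval J) \<and> A = \<Union>\<I>)"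
proof -
  have *: "definable A \<longleftrightarrow> (\<lambda>x. [x]) ` A \<in> M 1" for A :: "real set"
    using definable_iff[of "[1::real]" A] by simp
  have "inj (\<lambda>x::real. [x])" by (rule injI) simp
  then show ?thesis
    unfolding * o_minimal by (auto simp: inj_image_eq_iff)
qed

lemma definable_singleton_real: "definable {c::real}"
  unfolding definable_real_iff by (rule exI[of _ "{{c}}"]) (auto simp: is_interval_1)

lemma definable_finite_Ball:
  fixes P :: "'i \<Rightarrow> 'a::euclidean_space \<Rightarrow> bool"
  assumes "finite I" "\<And>i. i \<in> I \<Longrightarrow> definable {x. P i x}"
  shows "definable {x. \<forall>i\<in>I. P i x}"
  using assms
proof (induction I rule: finite_induct)
  case empty
  have "definable {x::'a. True}"
  proof -
    obtain bs :: "'a list" where bs: "distinct bs" "set bs = Basis" by (rule basis_enumeration)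
    have "definable ({}::'a set)" using o_minimal_real_field.empty[OF o_minimal_real_field_axioms]
      by (simp add: definable_iff[OF bs])
    from definable_Compl[OF this] show ?thesis by simp
  qed
  then show ?case by simp
next
  case (insert i I)
  then show ?case by (simp add: definable_conj)
qed

lemma definable_singleton: "definable {c::'a::euclidean_space}"
proof -
  have "{c} = {x. \<forall>b\<in>Basis. x \<bullet> b = c \<bullet> b}" by (auto intro: euclidean_eqI)
  moreover have "definable {x. x \<bullet> b = c \<bullet> b}" if "b \<in> Basis" for b
    using definable_vimage_coordinate_map[OF coordinate_map_inner[OF coordinate_map_id that] definable_singleton_real[of "c \<bullet> b"]]
    by simp
  ultimately show ?thesis by (simp add: definable_finite_Ball)
qed

lemma definable_diagonal: "definable {z::'a::euclidean_space \<times> 'a. fst z = snd z}"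
proof -
  have two: "DIM(real \<times> real) = 2" by simp
  have ds: "distinct [(1::real, 0::real), (0, 1)]" "set [(1::real, 0::real), (0, 1)] = Basis"
    by (auto simp: Basis_prod_def)
  have "{xs::real list. length xs = 2 \<and> hd xs = last xs} = coordinates [(1::real, 0::real), (0, 1)] ` {z. fst z = snd z}"
    by (auto simp: image_iff length_Suc_conv numeral_2_eq_2)
  then have real: "definable {z::real \<times> real. fst z = snd z}"
    using diagonal[of 2] unfolding definable_iff[OF ds] two by simp
  have "definable {z::'a \<times> 'a. fst z \<bullet> b = snd z \<bullet> b}" if "b \<in> Basis" for b
  proof -
    have "coordinate_map (\<lambda>z::'a \<times> 'a. (fst z \<bullet> b, snd z \<bullet> b))"
      using that by (intro coordinate_map_intros)
    from definable_vimage_coordinate_map[OF this real] show ?thesis by simp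
  qed
  then have "definable {z::'a \<times> 'a. \<forall>b\<in>Basis. fst z \<bullet> b = snd z \<bullet> b}"
    by (rule definable_finite_Ball[OF finite_Basis])
  then show ?thesis by (simp add: euclidean_eq_iff[symmetric])
qed

section \<open>Definable maps\<close>

definition definable_map :: "('a::euclidean_space \<Rightarrow> 'b::euclidean_space) \<Rightarrow> bool" where
  "definable_map t \<longleftrightarrow> definable {z. snd z = t (fst z)}"

lemma definable_vimage:
  assumes t: "definable_map t" and X: "definable X"
  shows "definable {x. t x \<in> X}"
proof -
  have "definable {z. snd z = t (fst z) \<and> snd z \<in> X}"
    using t unfolding definable_map_def
    by (intro definable_conj definable_vimage_coordinate_map[OF _ X] coordinate_map_intros)
  from definable_ex[OF this] show ?thesis by simp
qed

lemma definable_map_coordinate: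
  assumes "coordinate_map p" shows "definable_map p"
proof -
  have "coordinate_map (\<lambda>z. (p (fst z), snd z))"
    by (intro coordinate_map_intros coordinate_map_comp[OF _ assms])
  from definable_vimage_coordinate_map[OF this definable_diagonal]
  show ?thesis unfolding definable_map_def by (simp add: eq_commute)
qed

lemma definable_map_comp:
  assumes t: "definable_map t" and u: "definable_map u"
  shows "definable_map (\<lambda>x. u (t x))"
proof -
  have "definable {w. (\<lambda>w. (fst (fst w), snd w)) w \<in> {z. snd z = t (fst z)}
      \<and> (\<lambda>w. (snd w, snd (fst w))) w \<in> {z. snd z = u (fst z)}}"
    using t u unfolding definable_map_def
    by (intro definable_conj definable_vimage_coordinate_map coordinate_map_intros)
  then have "definable {w. snd w = t (fst (fst w)) \<and> snd (fst w) = u (snd w)}" by simp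
  from definable_ex[OF this] show ?thesis unfolding definable_map_def by simp
qed

lemma definable_map_id: "definable_map (\<lambda>x. x)"
  by (intro definable_map_coordinate coordinate_map_intros)

lemma definable_map_fst: "definable_map t \<Longrightarrow> definable_map (\<lambda>x. fst (t x))"
  by (erule definable_map_comp) (intro definable_map_coordinate coordinate_map_intros)

lemma definable_map_snd: "definable_map t \<Longrightarrow> definable_map (\<lambda>x. snd (t x))"
  by (erule definable_map_comp) (intro definable_map_coordinate coordinate_map_intros)

lemma definable_map_Pair:
  assumes t: "definable_map t" and u: "definable_map u"
  shows "definable_map (\<lambda>x. (t x, u x))"
proof -
  have "definable {w. (\<lambda>w. (fst w, fst (snd w))) w \<in> {z. snd z = t (fst z)}
      \<and> (\<lambda>w. (fst w, snd (snd w))) w \<in> {z. snd z = u (fst z)}}"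
    using t u unfolding definable_map_def
    by (intro definable_conj definable_vimage_coordinate_map coordinate_map_intros)
  then show ?thesis unfolding definable_map_def by (simp add: prod_eq_iff)
qed

lemma definable_map_const: "definable_map (\<lambda>x. c)"
  using definable_vimage_coordinate_map[OF coordinate_map_snd[OF coordinate_map_id] definable_singleton[of c]]
  unfolding definable_map_def by simp

lemma definable_eq: "definable_map t \<Longrightarrow> definable_map u \<Longrightarrow> definable {x. t x = u x}"
  using definable_vimage[OF definable_map_Pair definable_diagonal, of t u] by simp

lemma definable_less:
  assumes t: "definable_map t" and u: "definable_map u"
  shows "definable {x. (t x::real) < u x}"
proof -
  have two: "DIM(real \<times> real) = 2" by simp
  have ds: "distinct [(1::real, 0::real), (0, 1)]" "set [(1::real, 0::real), (0, 1)] = Basis"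
    by (auto simp: Basis_prod_def)
  have "{[x, y] | x y. x < (y::real)} = coordinates [(1::real, 0::real), (0, 1)] ` {z. fst z < snd z}"
    by (auto simp: image_iff)
  then have "definable {z::real \<times> real. fst z < snd z}"
    using order unfolding definable_iff[OF ds] two by simp
  from definable_vimage[OF definable_map_Pair[OF t u] this] show ?thesis by simp
qed

lemma definable_le:
  "definable_map t \<Longrightarrow> definable_map u \<Longrightarrow> definable {x. (t x::real) \<le> u x}"
  using definable_not[OF definable_less[of u t]] by (simp add: not_less)

lemma definable_map_binary:
  fixes op :: "real \<Rightarrow> real \<Rightarrow> real"
  assumes M: "{[x, y, op x y] | x y. True} \<in> M 3" and t: "definable_map t" and u: "definable_map u"
  shows "definable_map (\<lambda>x. op (t x) (u x))"
proof -
  let ?ds = "[((1::real, 0::real), 0::real), ((0, 1), 0), ((0, 0), 1)]"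
  have three: "DIM((real \<times> real) \<times> real) = 3" by simp
  have ds: "distinct ?ds" "set ?ds = Basis"
    by (auto simp: Basis_prod_def zero_prod_def)
  have "{[x, y, op x y] | x y. True} = coordinates ?ds ` {z. snd z = op (fst (fst z)) (snd (fst z))}"
    by (auto simp: image_iff)
  then have "definable {z. snd z = op (fst (fst z)) (snd (fst z))}"
    using M unfolding definable_iff[OF ds] three by simp
  then have "definable_map (\<lambda>z. op (fst z) (snd z))" unfolding definable_map_def .
  from definable_map_comp[OF definable_map_Pair[OF t u] this] show ?thesis by simp
qed

lemmas definable_map_add_real = definable_map_binary[OF addition]
  and definable_map_mult = definable_map_binary[OF multiplication]

lemma definable_map_component:
  "b \<in> Basis \<Longrightarrow> definable_map t \<Longrightarrow> definable_map (\<lambda>x. t x \<bullet> b)"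
  by (erule definable_map_comp) (intro definable_map_coordinate coordinate_map_intros)

lemma definable_map_componentwise:
  fixes t :: "'a::euclidean_space \<Rightarrow> 'b::euclidean_space"
  assumes "\<And>b. b \<in> Basis \<Longrightarrow> definable_map (\<lambda>x. t x \<bullet> b)"
  shows "definable_map t"
proof -
  have "definable {z::'a \<times> 'b. \<forall>b\<in>Basis. snd z \<bullet> b = t (fst z) \<bullet> b}"
    by (intro definable_finite_Ball definable_eq definable_map_component
        definable_map_comp[OF definable_map_fst[OF definable_map_id] assms]
        definable_map_snd definable_map_id finite_Basis)
  then show ?thesis unfolding definable_map_def by (simp add: euclidean_eq_iff[symmetric])
qed

lemma definable_map_sum_real:
  assumes "\<And>i. i \<in> I \<Longrightarrow> definable_map (t i :: _ \<Rightarrow> real)"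
  shows "definable_map (\<lambda>x. \<Sum>i\<in>I. t i x)"
  using assms
  by (induction I rule: infinite_finite_induct) (auto intro: definable_map_const definable_map_add_real)

lemma definable_map_inner:
  assumes "definable_map t" "definable_map u"
  shows "definable_map (\<lambda>x. t x \<bullet> u x)"
proof -
  have "definable_map (\<lambda>x. \<Sum>b\<in>Basis. (t x \<bullet> b) * (u x \<bullet> b))"
    by (intro definable_map_sum_real definable_map_mult definable_map_component assms)
  then show ?thesis by (simp add: euclidean_inner[symmetric])
qed

lemma definable_map_add:
  "definable_map t \<Longrightarrow> definable_map u \<Longrightarrow> definable_map (\<lambda>x. t x + u x)"
  by (rule definable_map_componentwise)
    (simp add: inner_add_left definable_map_add_real definable_map_component)

lemma definable_map_scaleR:
  "definable_map t \<Longrightarrow> definable_map u \<Longrightarrow> definable_map (\<lambda>x. t x *\<^sub>R u x)"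
  by (rule definable_map_componentwise)
    (simp add: definable_map_mult definable_map_component)

lemma definable_map_diff:
  assumes "definable_map t" "definable_map u"
  shows "definable_map (\<lambda>x. t x - u x)"
  using definable_map_add[OF assms(1) definable_map_scaleR[OF definable_map_const[of "-1"] assms(2)]]
  by simp

lemma definable_map_norm:
  fixes t :: "'a::euclidean_space \<Rightarrow> 'b::euclidean_space"
  assumes t: "definable_map t"
  shows "definable_map (\<lambda>x. norm (t x))"
proof -
  \<comment> \<open>The norm is characterised as a nonnegative root, which only takes multiplication
    and order.\<close>
  have eq: "s = norm y \<longleftrightarrow> 0 \<le> s \<and> s * s = y \<bullet> y" for s and y :: 'b
    by (metis abs_of_nonneg norm_ge_zero power2_eq_iff_nonneg power2_eq_square power2_norm_eq_inner)
  show ?thesis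
    unfolding definable_map_def eq
    by (intro definable_conj definable_le definable_eq definable_map_inner definable_map_mult
        definable_map_const definable_map_comp[OF definable_map_fst[OF definable_map_id] t]
        definable_map_snd definable_map_id)
qed

lemma definable_map_abs:
  "definable_map t \<Longrightarrow> definable_map (\<lambda>x. \<bar>t x :: real\<bar>)"
  using definable_map_norm[of t] by simp

text \<open>With these rules definability follows the syntax of a formula whose bound variables
  range over Euclidean spaces. This is why derivatives, limits and normals are later brought into
  epsilon-delta form.\<close>

lemmas definable_intros =
  definable_not definable_conj definable_disj definable_imp definable_ex definable_all
  definable_eq definable_less definable_le
  definable_map_id definable_map_fst definable_map_snd definable_map_Pair definable_map_const
  definable_map_add definable_map_diff definable_map_mult definable_map_scaleR definable_map_inner
  definable_map_sum_real definable_map_norm definable_map_abs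


section \<open>Definable choice\<close>

text \<open>One of the finitely many intervals that make up \<open>A\<close> must be infinite, and
  two of its points span an open interval inside it.\<close>

lemma infinite_definable_contains_interval:
  fixes A :: "real set"
  assumes "definable A" "infinite A"
  obtains c d where "c < d" "{c<..<d} \<subseteq> A"
proof -
  obtain \<I> where I: "finite \<I>" "\<And>J. J \<in> \<I> \<Longrightarrow> is_interval J" "A = \<Union>\<I>"
    using assms(1) unfolding definable_real_iff by blast
  then obtain J where J: "J \<in> \<I>" "infinite J" using assms(2) by (meson finite_Union)
  then obtain c where c: "c \<in> J" using infinite_imp_nonempty by blast
  from J have "infinite (J - {c})" by simp
  then obtain d where d: "d \<in> J" "d \<noteq> c" using infinite_imp_nonempty by blast
  have "{min c d<..<max c d} \<subseteq> J"
  proof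
    fix x assume "x \<in> {min c d<..<max c d}"
    moreover have "min c d \<in> J" "max c d \<in> J" using c d(1) by (simp_all add: min_def max_def)
    ultimately show "x \<in> J"
      using mem_is_interval_1_I[OF I(2)[OF J(1)], of "min c d" "max c d" x] by simp
  qed
  moreover have "min c d < max c d" using d by auto
  ultimately show ?thesis using that I(3) J(1) by blast
qed

text \<open>An interval that meets every right neighbourhood of \<open>c\<close> contains one, by
  convexity. With finitely many intervals, either one of them does so or all of them stay away from
  \<open>c\<close> on the right.\<close>

lemma definable_eventually_at_right:
  assumes "definable {x::real. P x}"
  shows "eventually P (at_right c) \<or> eventually (\<lambda>x. \<not> P x) (at_right c)"
proof -
  obtain \<I> where I: "finite \<I>" "\<And>J. J \<in> \<I> \<Longrightarrow> is_interval J" "{x. P x} = \<Union>\<I>"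
    using assms(1) unfolding definable_real_iff by blast
  have *: "eventually (\<lambda>x. x \<in> J) (at_right c) \<or> eventually (\<lambda>x. x \<notin> J) (at_right c)" if J: "is_interval J" for J
  proof (rule disjCI)
    assume "\<not> eventually (\<lambda>x. x \<notin> J) (at_right c)"
    then have fr: "\<exists>y>c. y < d \<and> y \<in> J" if "c < d" for d
      using that unfolding eventually_at_right_field by auto
    obtain y where y: "c < y" "y \<in> J" using fr[of "c + 1"] by auto
    have "x \<in> J" if x: "c < x" "x < y" for x
    proof -
      obtain z where "c < z" "z < x" "z \<in> J" using fr[OF x(1)] by auto
      then show ?thesis using mem_is_interval_1_I[OF J, of z y x] y x by simp
    qed
    then show "eventually (\<lambda>x. x \<in> J) (at_right c)"
      using y(1) unfolding eventually_at_right_field by auto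
  qed
  have P: "P x \<longleftrightarrow> (\<exists>J\<in>\<I>. x \<in> J)" for x using I(3) by auto
  show ?thesis
  proof (cases "\<exists>J\<in>\<I>. eventually (\<lambda>x. x \<in> J) (at_right c)")
    case True
    then show ?thesis unfolding P by (auto elim!: eventually_mono)
  next
    case False
    then have "\<forall>J\<in>\<I>. eventually (\<lambda>x. x \<notin> J) (at_right c)" using * I(2) by blast
    then show ?thesis using eventually_ball_finite[OF I(1)] unfolding P by fastforce
  qed
qed

lemma definable_eventually_at_left:
  assumes "definable {x::real. P x}"
  shows "eventually P (at_left c) \<or> eventually (\<lambda>x. \<not> P x) (at_left c)"
proof -
  have "definable_map (\<lambda>x::real. 0 - x)" by (intro definable_intros)
  from definable_vimage[OF this assms] have "definable {x. P (- x)}" by simp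
  then show ?thesis
    using definable_eventually_at_right[of "\<lambda>x. P (- x)" "- c"]
    by (simp add: eventually_at_left_to_right[of _ c])
qed

lemma definable_choice_nonneg:
  fixes X :: "('a::euclidean_space \<times> real) set"
  assumes X: "definable X" and nonneg: "X \<subseteq> {z. 0 \<le> snd z}"
  shows "\<exists>Y. definable Y \<and> Y \<subseteq> X \<and> (\<forall>x y. (x, y) \<in> X \<longrightarrow> (\<exists>!z. (x, z) \<in> Y))"
proof -
  \<comment> \<open>Choose the infimum \<open>l\<close> of a fibre that contains it, and otherwise the midpoint of the longest
    interval of length at most \<open>1\<close> of the fibre that starts at \<open>l\<close>.\<close>
  define glb where "glb x l \<longleftrightarrow> (\<forall>y. (x, y) \<in> X \<longrightarrow> l \<le> y) \<and>
      (\<forall>m. (\<forall>y. (x, y) \<in> X \<longrightarrow> m \<le> y) \<longrightarrow> m \<le> l)" for x l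
  define H where "H x l h \<longleftrightarrow> 0 < h \<and> h \<le> 1 \<and> (\<forall>z. l < z \<and> z < l + h \<longrightarrow> (x, z) \<in> X)" for x l h
  define lub where "lub x l s \<longleftrightarrow> (\<forall>h. H x l h \<longrightarrow> h \<le> s) \<and> (\<forall>m. (\<forall>h. H x l h \<longrightarrow> h \<le> m) \<longrightarrow> s \<le> m)" for x l s
  \<comment> \<open>The equation \<open>snd z + snd z = l + l + s\<close> expresses
    \<open>l + s / 2\<close> by addition alone. The bound \<open>h \<le> 1\<close> in
    \<open>H\<close> keeps the supremum \<open>s\<close> finite when the fibre contains a
    half-line.\<close>
  define Y where "Y = {z. \<exists>l. glb (fst z) l \<and> ((fst z, l) \<in> X \<and> snd z = l \<or>
      (fst z, l) \<notin> X \<and> (\<exists>s. lub (fst z) l s \<and> snd z + snd z = l + l + s))}"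
  have "definable Y"
    unfolding Y_def glb_def lub_def H_def
    by (intro definable_intros definable_vimage[OF _ X])
  moreover have unique: "\<exists>z. (\<forall>y. (x, y) \<in> Y \<longleftrightarrow> y = z) \<and> (x, z) \<in> X" if xy: "(x, y) \<in> X" for x y
  proof -
    let ?A = "{y. (x, y) \<in> X}"
    have A: "?A \<noteq> {}" "bdd_below ?A" using xy nonneg by (auto intro!: bdd_belowI[of _ 0])
    have glb: "glb x l \<longleftrightarrow> l = Inf ?A" for l
    proof
      assume "glb x l"
      then have *: "(\<forall>y. (x, y) \<in> X \<longrightarrow> l \<le> y)" "\<And>m. (\<And>y. (x, y) \<in> X \<Longrightarrow> m \<le> y) \<Longrightarrow> m \<le> l"
        unfolding glb_def by auto
      have "l \<le> Inf ?A" using *(1) A by (intro cInf_greatest) auto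
      moreover have "Inf ?A \<le> l" using A by (intro *(2) cInf_lower) auto
      ultimately show "l = Inf ?A" by simp
    next
      assume "l = Inf ?A"
      then show "glb x l"
        unfolding glb_def using A by (auto intro!: cInf_lower cInf_greatest)
    qed
    define l where "l = Inf ?A"
    show ?thesis
    proof (cases "(x, l) \<in> X")
      case True
      then show ?thesis by (auto simp: Y_def glb l_def[symmetric])
    next
      case False
      let ?H = "{h. H x l h}"
      have "definable {y. (x, y) \<in> X}" by (intro definable_intros definable_vimage[OF _ X])
      then have "eventually (\<lambda>y. (x, y) \<in> X) (at_right l) \<or> eventually (\<lambda>y. (x, y) \<notin> X) (at_right l)"
        by (rule definable_eventually_at_right)
      \<comment> \<open>An infimum that is not attained is approached from the right, so the
        dichotomy leaves only the case that a whole right neighbourhood of \<open>l\<close> lies in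
        the fibre.\<close>
      moreover have "\<not> eventually (\<lambda>y. (x, y) \<notin> X) (at_right l)"
      proof
        assume "eventually (\<lambda>y. (x, y) \<notin> X) (at_right l)"
        then obtain b where b: "b > l" "\<And>y. l < y \<Longrightarrow> y < b \<Longrightarrow> (x, y) \<notin> X"
          unfolding eventually_at_right_field by auto
        have "b \<le> y" if "(x, y) \<in> X" for y
        proof -
          have "l \<le> y" unfolding l_def using that A by (auto intro: cInf_lower)
          then show ?thesis using b that False by (metis less_le not_le)
        qed
        then have "b \<le> l" unfolding l_def using A by (auto intro!: cInf_greatest)
        then show False using b(1) by simp
      qed
      ultimately obtain b where b: "b > l" "\<And>y. l < y \<Longrightarrow> y < b \<Longrightarrow> (x, y) \<in> X"
        unfolding eventually_at_right_field by auto
      have h: "H x l (min 1 (b - l))" unfolding H_def using b by auto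
      have bdd: "bdd_above ?H" unfolding H_def by (auto intro!: bdd_aboveI[of _ 1])
      define s where "s = Sup ?H"
      have lub: "lub x l t \<longleftrightarrow> t = s" for t
      proof
        assume "lub x l t"
        then have *: "\<And>h. H x l h \<Longrightarrow> h \<le> t" "\<And>m. (\<And>h. H x l h \<Longrightarrow> h \<le> m) \<Longrightarrow> t \<le> m"
          unfolding lub_def by auto
        have "s \<le> t" unfolding s_def using h by (intro cSup_least *(1)) auto
        moreover have "t \<le> s" unfolding s_def using bdd by (intro *(2) cSup_upper) auto
        ultimately show "t = s" by simp
      next
        assume "t = s"
        then show "lub x l t" unfolding lub_def s_def using h bdd
          by (auto intro!: cSup_upper cSup_least)
      qed
      have "min 1 (b - l) \<le> s" unfolding s_def using h bdd by (auto intro: cSup_upper)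
      then have s: "0 < s" using b(1) by auto
      then have "s / 2 < Sup ?H" unfolding s_def by simp
      then obtain h where "H x l h" "s / 2 < h" using less_cSupE[of "s / 2" ?H] h by blast
      then have "(x, l + s / 2) \<in> X" unfolding H_def using s by auto
      moreover have "(x, y) \<in> Y \<longleftrightarrow> y = l + s / 2" for y
        using False by (auto simp: Y_def glb l_def[symmetric] lub)
      ultimately show ?thesis by blast
    qed
  qed
  moreover have "Y \<subseteq> X"
  proof
    fix z assume z: "z \<in> Y"
    have "\<exists>y. (fst z, y) \<in> X"
    proof (rule ccontr)
      assume "\<nexists>y. (fst z, y) \<in> X"
      \<comment> \<open>Over an empty fibre every number is a lower bound, so there is no greatest
        one.\<close>
      then have "\<not> glb (fst z) l" for l unfolding glb_def by (auto intro: exI[of _ "l + 1"])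
      then show False using z unfolding Y_def by blast
    qed
    then obtain y where "(fst z, y) \<in> X" by blast
    from unique[OF this] show "z \<in> X" using z by (metis prod.collapse)
  qed
  ultimately show ?thesis by (intro exI[of _ Y]) (simp, metis)
qed

text \<open>The nonnegative case, where infima of fibres exist, is used twice: on the nonnegative
  part of a fibre if there is one, and otherwise on the reflected fibre.\<close>

lemma definable_choice_real:
  fixes X :: "('a::euclidean_space \<times> real) set"
  assumes X: "definable X"
  shows "\<exists>Y. definable Y \<and> Y \<subseteq> X \<and> (\<forall>x y. (x, y) \<in> X \<longrightarrow> (\<exists>!z. (x, z) \<in> Y))"
proof -
  let ?N = "\<lambda>x. \<exists>y. (x, y) \<in> X \<and> 0 \<le> y"
  let ?X1 = "{z. z \<in> X \<and> 0 \<le> snd z}"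
  let ?X2 = "{z. (fst z, 0 - snd z) \<in> X \<and> 0 \<le> snd z \<and> \<not> ?N (fst z)}"
  have X1: "definable ?X1" "?X1 \<subseteq> {z. 0 \<le> snd z}"
    by (intro definable_intros definable_vimage[OF _ X]) auto
  from definable_choice_nonneg[OF X1] obtain Y1 where Y1: "definable Y1" "Y1 \<subseteq> ?X1"
      "\<forall>x y. (x, y) \<in> ?X1 \<longrightarrow> (\<exists>!z. (x, z) \<in> Y1)"
    by blast
  have X2: "definable ?X2" "?X2 \<subseteq> {z. 0 \<le> snd z}"
    by (intro definable_intros definable_vimage[OF _ X]) auto
  from definable_choice_nonneg[OF X2] obtain Y2 where Y2: "definable Y2" "Y2 \<subseteq> ?X2"
      "\<forall>x y. (x, y) \<in> ?X2 \<longrightarrow> (\<exists>!z. (x, z) \<in> Y2)"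
    by blast
  let ?Y = "{z. z \<in> Y1 \<or> (fst z, 0 - snd z) \<in> Y2}"
  have "definable ?Y" by (intro definable_intros definable_vimage[OF _ Y1(1)] definable_vimage[OF _ Y2(1)])
  moreover have "?Y \<subseteq> X" using Y1(2) Y2(2) by auto
  moreover have "\<exists>!z. (x, z) \<in> ?Y" if xy: "(x, y) \<in> X" for x y
  proof (cases "?N x")
    case True
    then have "(x, z) \<notin> Y2" for z using subsetD[OF Y2(2), of "(x, z)"] by auto
    moreover have "\<exists>!z. (x, z) \<in> Y1" using True Y1(3) by auto
    ultimately show ?thesis by auto
  next
    case False
    then have "(x, z) \<notin> Y1" for z using subsetD[OF Y1(2), of "(x, z)"] by auto
    moreover have "y \<le> 0" using False xy by (metis linear)
    then have "(x, - y) \<in> ?X2" using False xy by simp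
    then have "\<exists>!z. (x, z) \<in> Y2" using Y2(3) by blast
    then obtain z where "\<And>w. (x, w) \<in> Y2 \<longleftrightarrow> w = z" by metis
    ultimately show ?thesis by (auto intro!: ex1I[of _ "- z"])
  qed
  ultimately show ?thesis by (intro exI[of _ ?Y]) blast
qed

text \<open>The fibres are thinned out one coordinate at a time. For each basis vector the
  one-dimensional choice is applied to the set of values of that coordinate, and the points with the
  chosen value are kept.\<close>

lemma definable_choice:
  fixes X :: "('a::euclidean_space \<times> 'b::euclidean_space) set"
  assumes X: "definable X"
  shows "\<exists>f. definable_map f \<and> (\<forall>x y. (x, y) \<in> X \<longrightarrow> (x, f x) \<in> X)"
proof -
  have "\<exists>Y. definable Y \<and> Y \<subseteq> X \<and> (\<forall>x y. (x, y) \<in> X \<longrightarrow> (\<exists>z. (x, z) \<in> Y)) \<and>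
      (\<forall>b\<in>B. \<forall>x y z. (x, y) \<in> Y \<longrightarrow> (x, z) \<in> Y \<longrightarrow> y \<bullet> b = z \<bullet> b)"
    if "finite B" "B \<subseteq> Basis" for B :: "'b set"
    using that
  proof (induction B rule: finite_induct)
    case empty
    then show ?case using X by blast
  next
    case (insert b B)
    then obtain Y where Y: "definable Y" "Y \<subseteq> X" "\<And>x y. (x, y) \<in> X \<Longrightarrow> \<exists>z. (x, z) \<in> Y"
        "\<And>b x y z. b \<in> B \<Longrightarrow> (x, y) \<in> Y \<Longrightarrow> (x, z) \<in> Y \<Longrightarrow> y \<bullet> b = z \<bullet> b"
      by (metis insert_subset)
    have "definable {w. \<exists>y. (fst w, y) \<in> Y \<and> snd w = y \<bullet> b}"
      by (intro definable_intros definable_vimage[OF _ Y(1)])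
    from definable_choice_real[OF this] obtain Z where Z: "definable Z" "Z \<subseteq> {w. \<exists>y. (fst w, y) \<in> Y \<and> snd w = y \<bullet> b}"
        "\<And>x t. (x, t) \<in> {w. \<exists>y. (fst w, y) \<in> Y \<and> snd w = y \<bullet> b} \<Longrightarrow> \<exists>!z. (x, z) \<in> Z"
      by blast
    let ?Y = "{w. w \<in> Y \<and> (fst w, snd w \<bullet> b) \<in> Z}"
    have "definable ?Y" by (intro definable_intros definable_vimage[OF _ Y(1)] definable_vimage[OF _ Z(1)])
    moreover have "\<exists>z. (x, z) \<in> ?Y" if "(x, y) \<in> X" for x y
    proof -
      obtain z where "(x, z) \<in> Y" using Y(3)[OF \<open>(x, y) \<in> X\<close>] by blast
      then obtain t where "(x, t) \<in> Z" using Z(3)[of x "z \<bullet> b"] by auto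
      moreover from this obtain u where "(x, u) \<in> Y" "t = u \<bullet> b" using Z(2) by auto
      ultimately show ?thesis by auto
    qed
    moreover have "y \<bullet> c = z \<bullet> c" if c: "c \<in> insert b B" and *: "(x, y) \<in> ?Y" "(x, z) \<in> ?Y" for c x y z
    proof (cases "c = b")
      case True
      have "(x, y \<bullet> b) \<in> Z" "(x, z \<bullet> b) \<in> Z" "(x, y) \<in> Y" using * by auto
      then show ?thesis using Z(3)[of x "y \<bullet> b"] True by auto
    next
      case False
      then show ?thesis using Y(4)[of c x y z] c * by auto
    qed
    moreover have "?Y \<subseteq> X" using Y(2) by auto
    ultimately show ?case by (intro exI[of _ ?Y]) blast
  qed
  from this[OF finite_Basis subset_refl] obtain Y where Y: "definable Y" "Y \<subseteq> X"
      "\<forall>x y. (x, y) \<in> X \<longrightarrow> (\<exists>z. (x, z) \<in> Y)"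
      "\<forall>b\<in>Basis. \<forall>x y z. (x, y) \<in> Y \<longrightarrow> (x, z) \<in> Y \<longrightarrow> y \<bullet> b = z \<bullet> b"
    by blast
  \<comment> \<open>The value 0 over empty fibres makes \<open>f\<close> total and keeps its graph
    first-order.\<close>
  define f where "f x = (if \<exists>y. (x, y) \<in> Y then SOME y. (x, y) \<in> Y else 0)" for x
  have f: "(x, f x) \<in> Y" if "(x, y) \<in> Y" for x y
    using that someI[of "\<lambda>y. (x, y) \<in> Y"] unfolding f_def by auto
  have "y = f x \<longleftrightarrow> (x, y) \<in> Y \<or> \<not> (\<exists>z. (x, z) \<in> Y) \<and> y = 0" for x y
  proof (cases "\<exists>z. (x, z) \<in> Y")
    case True
    then have "(x, f x) \<in> Y" using f by blast
    moreover have "y = f x" if "(x, y) \<in> Y"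
      using Y(4) that \<open>(x, f x) \<in> Y\<close> by (subst euclidean_eq_iff) blast
    ultimately show ?thesis using True by blast
  qed (simp add: f_def)
  then have "definable_map f" unfolding definable_map_def
    by (simp, intro definable_intros definable_vimage[OF _ Y(1)])
  then show ?thesis using f Y(2,3) by (intro exI[of _ f]) blast
qed

end

section \<open>Differentiability of definable functions\<close>

text \<open>A strict local minimum is the only strict minimum over some interval with rational end
  points, and there are countably many such intervals.\<close>

lemma countable_strict_local_minima:
  fixes g :: "real \<Rightarrow> real"
  shows "countable {x. eventually (\<lambda>y. g x < g y) (at x)}"
proof -
  let ?E = "\<lambda>(p, q). {x. p < x \<and> x < q \<and> (\<forall>y. p < y \<and> y < q \<and> y \<noteq> x \<longrightarrow> g x < g y)}"
  have "countable (?E z)" for z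
  proof -
    obtain p q where z: "z = (p, q)" by (cases z)
    have "x = y" if "x \<in> ?E z" "y \<in> ?E z" for x y
    proof (rule ccontr)
      assume "x \<noteq> y"
      then have "g x < g y" "g y < g x" using that z by auto
      then show False by simp
    qed
    then obtain x where "?E z \<subseteq> {x}" by blast
    then show ?thesis by (rule countable_subset) simp
  qed
  then have "countable (\<Union>z\<in>\<rat> \<times> \<rat>. ?E z)" by (simp add: countable_rat)
  moreover have "{x. eventually (\<lambda>y. g x < g y) (at x)} \<subseteq> (\<Union>z\<in>\<rat> \<times> \<rat>. ?E z)"
  proof
    fix x assume "x \<in> {x. eventually (\<lambda>y. g x < g y) (at x)}"
    then obtain d where d: "d > 0" "\<And>y. y \<noteq> x \<Longrightarrow> dist y x < d \<Longrightarrow> g x < g y"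
      unfolding eventually_at by auto
    obtain p where p: "p \<in> \<rat>" "x - d < p" "p < x" using Rats_dense_in_real[of "x - d" x] d by auto
    obtain q where q: "q \<in> \<rat>" "x < q" "q < x + d" using Rats_dense_in_real[of x "x + d"] d by auto
    have "g x < g y" if "p < y" "y < q" "y \<noteq> x" for y
      using d(2) that p q by (auto simp: dist_real_def)
    then show "x \<in> (\<Union>z\<in>\<rat> \<times> \<rat>. ?E z)" using p q by auto
  qed
  ultimately show ?thesis by (rule countable_subset[rotated])
qed

text \<open>The local comparisons are glued by bisection. This replaces the mean value theorem for
  functions with infinite slopes.\<close>

lemma locally_increasing_imp_le:
  fixes g :: "real \<Rightarrow> real"
  assumes "a \<le> b"
    and "\<And>x. a \<le> x \<Longrightarrow> x \<le> b \<Longrightarrow> eventually (\<lambda>y. if x < y then g x \<le> g y else g y \<le> g x) (at x)"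
  shows "g a \<le> g b"
  using assms(1)
proof (induction rule: Bolzano)
  case (local x)
  from assms(2)[OF this] obtain d where d: "d > 0"
      "\<And>y. y \<noteq> x \<Longrightarrow> dist y x < d \<Longrightarrow> if x < y then g x \<le> g y else g y \<le> g x"
    unfolding eventually_at by auto
  have "g u \<le> g v" if "u \<le> x" "x \<le> v" "v - u < d" for u v
  proof -
    have "g u \<le> g x" using d(2)[of u] that by (cases "u = x") (auto simp: dist_real_def)
    moreover have "g x \<le> g v" using d(2)[of v] that by (cases "v = x") (auto simp: dist_real_def)
    ultimately show ?thesis by simp
  qed
  then show ?case using d(1) by blast
qed simp

text \<open>The limit is the supremum of the levels that \<open>s\<close> eventually exceeds; by the
  dichotomy \<open>s\<close> eventually stays at or below every level above it.\<close>

lemma ereal_limit_of_dichotomy: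
  fixes s :: "'a \<Rightarrow> real"
  assumes dichotomy: "\<And>q. eventually (\<lambda>y. q < s y) F \<or> eventually (\<lambda>y. \<not> q < s y) F"
  obtains l :: ereal where "((\<lambda>y. ereal (s y)) \<longlongrightarrow> l) F"
proof
  let ?A = "{ereal q | q. eventually (\<lambda>y. q < s y) F}"
  show "((\<lambda>y. ereal (s y)) \<longlongrightarrow> Sup ?A) F"
  proof (rule order_tendstoI)
    fix a assume "a < Sup ?A"
    then obtain q where "eventually (\<lambda>y. q < s y) F" "a < ereal q" unfolding less_Sup_iff by auto
    then show "eventually (\<lambda>y. a < ereal (s y)) F"
      by (auto elim!: eventually_mono intro: less_trans)
  next
    fix a assume "Sup ?A < a"
    then obtain q where q: "Sup ?A < ereal q" "ereal q < a" using ereal_dense2 by blast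
    have "\<not> eventually (\<lambda>y. q < s y) F"
    proof
      assume "eventually (\<lambda>y. q < s y) F"
      then have "ereal q \<le> Sup ?A" by (intro Sup_upper) auto
      then show False using q(1) by simp
    qed
    then have "eventually (\<lambda>y. \<not> q < s y) F" using dichotomy by blast
    then show "eventually (\<lambda>y. ereal (s y) < a) F"
      using q(2) by (auto elim!: eventually_mono simp: not_less intro: le_less_trans[of _ "ereal q"])
  qed
qed

context o_minimal_real_field
begin

lemma definable_map_divide:
  assumes t: "definable_map t" and u: "definable_map u"
  shows "definable_map (\<lambda>x. (t x :: real) / u x)"
proof -
  have eq: "s = a / b \<longleftrightarrow> b = 0 \<and> s = 0 \<or> b \<noteq> 0 \<and> s * b = a" for s a b :: real
    by (cases "b = 0") (auto simp: field_simps)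
  show ?thesis
    unfolding definable_map_def eq
    by (intro definable_intros definable_map_comp[OF _ t] definable_map_comp[OF _ u])
qed

lemma definable_eventually_at:
  fixes P :: "'a::euclidean_space \<Rightarrow> real \<Rightarrow> bool"
  assumes P: "definable {z. P (fst z) (snd z)}" and c: "definable_map c"
  shows "definable {x. eventually (P x) (at (c x))}"
proof -
  have "definable {x. \<exists>d. 0 < d \<and> (\<forall>y. \<not> y = c x \<and> norm (y - c x) < d \<longrightarrow> (x, y) \<in> {z. P (fst z) (snd z)})}"
    by (intro definable_intros definable_vimage[OF _ P] definable_map_comp[OF _ c])
  then show ?thesis by (simp add: eventually_at dist_norm)
qed

lemma definable_has_vector_derivative:
  fixes f :: "'a::euclidean_space \<Rightarrow> real \<Rightarrow> 'b::euclidean_space"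
  assumes f: "definable_map (\<lambda>z. f (fst z) (snd z))"
    and w: "definable_map w" and c: "definable_map c"
  shows "definable {x. (f x has_vector_derivative w x) (at (c x))}"
proof -
  have "definable {x. \<forall>e. 0 < e \<longrightarrow> (\<exists>d. 0 < d \<and> (\<forall>y. norm (y - c x) < d \<longrightarrow>
      norm ((\<lambda>z. f (fst z) (snd z)) (x, y) - (\<lambda>z. f (fst z) (snd z)) (x, c x) - (y - c x) *\<^sub>R w x)
        \<le> e * norm (y - c x)))}"
    by (intro definable_intros definable_map_comp[OF _ f] definable_map_comp[OF _ c] definable_map_comp[OF _ w])
  then show ?thesis
    by (simp add: has_vector_derivative_def has_derivative_at_alt bounded_linear_scaleR_left)
qed

text \<open>If the slope were infinite at every point of an interval, \<open>f x - K * x\<close>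
  would increase around each point for every \<open>K\<close>. Taking \<open>K\<close> to be the
  mean slope between two points plus 1 gives a contradiction.\<close>

lemma finite_infinite_slope:
  fixes f :: "real \<Rightarrow> real"
  assumes f: "definable_map f"
  shows "finite {x. \<forall>q. eventually (\<lambda>y. q < (f y - f x) / (y - x)) (at x)}" (is "finite ?P")
proof (rule ccontr)
  have "definable ?P"
    by (intro definable_intros definable_eventually_at definable_map_divide definable_map_comp[OF _ f])
  moreover assume "infinite ?P"
  ultimately obtain c d where cd: "c < d" "{c<..<d} \<subseteq> ?P"
    by (rule infinite_definable_contains_interval)
  obtain u where u: "c < u" "u < d" using dense[OF cd(1)] by blast
  obtain v where v: "u < v" "v < d" using dense[OF u(2)] by blast
  define K where "K = (f v - f u) / (v - u) + 1"
  have "f u - K * u \<le> f v - K * v"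
  proof (rule locally_increasing_imp_le[where g = "\<lambda>x. f x - K * x"])
    fix x assume "u \<le> x" "x \<le> v"
    then have "x \<in> {c<..<d}" using u v by auto
    then have "x \<in> ?P" using cd(2) by blast
    then have "eventually (\<lambda>y. K < (f y - f x) / (y - x)) (at x)" by auto
    moreover have "eventually (\<lambda>y. y \<noteq> x) (at x)" by (simp add: eventually_at_filter)
    ultimately show "eventually (\<lambda>y. if x < y then f x - K * x \<le> f y - K * y else f y - K * y \<le> f x - K * x) (at x)"
    proof eventually_elim
      case (elim y)
      then show ?case
        by (cases "x < y") (auto simp: divide_simps algebra_simps split: if_splits)
    qed
  qed (use v in simp)
  then have "K * (v - u) \<le> f v - f u" by (simp add: algebra_simps)
  moreover have "K * (v - u) = f v - f u + (v - u)" using v by (simp add: K_def field_simps)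
  ultimately show False using v by simp
qed

text \<open>By o-minimality the one-sided slopes converge in the extended reals. If they differ, then
  \<open>f y - q * y\<close> or its negative has a strict local minimum for some rational \<open>q\<close> in between, which
  happens only countably often.\<close>

lemma finite_nondifferentiable_real:
  fixes f :: "real \<Rightarrow> real"
  assumes f: "definable_map f"
  shows "finite {x. \<not> f differentiable at x}" (is "finite ?N")
proof (rule ccontr)
  let ?s = "\<lambda>x y. (f y - f x) / (y - x)"
  let ?C = "\<lambda>g. \<Union>q\<in>\<rat>. {x. eventually (\<lambda>y. g x - q * x < g y - q * y) (at x)}"
  let ?P = "\<lambda>f. {x. \<forall>q. eventually (\<lambda>y. q < (f y - f x) / (y - x)) (at x)}"
  have mf: "definable_map (\<lambda>x. 0 - f x)" by (intro definable_intros f)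
  have "?N \<subseteq> (?C f \<union> ?C (\<lambda>x. 0 - f x)) \<union> (?P f \<union> ?P (\<lambda>x. 0 - f x))"
  proof
    fix x assume x: "x \<in> ?N"
    have def: "definable {y. q < ?s x y}" for q
      by (intro definable_intros definable_map_divide definable_map_comp[OF _ f])
    obtain l2 where l2: "((\<lambda>y. ereal (?s x y)) \<longlongrightarrow> l2) (at_right x)"
      using ereal_limit_of_dichotomy[OF definable_eventually_at_right[OF def]] by blast
    obtain l1 where l1: "((\<lambda>y. ereal (?s x y)) \<longlongrightarrow> l1) (at_left x)"
      using ereal_limit_of_dichotomy[OF definable_eventually_at_left[OF def]] by blast
    have right: "eventually (\<lambda>y. x < y) (at_right x)" by (simp add: eventually_at_filter)
    have left: "eventually (\<lambda>y. y < x) (at_left x)" by (simp add: eventually_at_filter)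
    consider "l1 < l2" | "l2 < l1" | "l1 = l2" by fastforce
    then show "x \<in> (?C f \<union> ?C (\<lambda>x. 0 - f x)) \<union> (?P f \<union> ?P (\<lambda>x. 0 - f x))"
    proof cases
      case 1
      then obtain q where q: "l1 < ereal (real_of_rat q)" "ereal (real_of_rat q) < l2" using ereal_dense3 by blast
      let ?q = "real_of_rat q"
      have "eventually (\<lambda>y. f x - ?q * x < f y - ?q * y) (at_left x)"
        using order_tendstoD(2)[OF l1 q(1)] left
        by eventually_elim (auto simp: divide_simps algebra_simps split: if_splits)
      moreover have "eventually (\<lambda>y. f x - ?q * x < f y - ?q * y) (at_right x)"
        using order_tendstoD(1)[OF l2 q(2)] right
        by eventually_elim (auto simp: divide_simps algebra_simps split: if_splits)
      ultimately have "eventually (\<lambda>y. f x - ?q * x < f y - ?q * y) (at x)"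
        by (simp add: eventually_at_split)
      then show ?thesis by (auto simp: Rats_def)
    next
      case 2
      then obtain q where q: "l2 < ereal (real_of_rat q)" "ereal (real_of_rat q) < l1" using ereal_dense3 by blast
      let ?q = "real_of_rat (- q)"
      have "eventually (\<lambda>y. (0 - f x) - ?q * x < (0 - f y) - ?q * y) (at_left x)"
        using order_tendstoD(1)[OF l1 q(2)] left
        by eventually_elim (auto simp: of_rat_minus divide_simps algebra_simps split: if_splits)
      moreover have "eventually (\<lambda>y. (0 - f x) - ?q * x < (0 - f y) - ?q * y) (at_right x)"
        using order_tendstoD(2)[OF l2 q(1)] right
        by eventually_elim (auto simp: of_rat_minus divide_simps algebra_simps split: if_splits)
      ultimately have "eventually (\<lambda>y. (0 - f x) - ?q * x < (0 - f y) - ?q * y) (at x)"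
        by (simp add: eventually_at_split)
      then have "x \<in> ?C (\<lambda>x. 0 - f x)" by (intro UN_I[of ?q]) (simp_all add: Rats_def)
      then show ?thesis by blast
    next
      case 3
      then have l: "((\<lambda>y. ereal (?s x y)) \<longlongrightarrow> l1) (at x)"
        using l1 l2 filterlim_split_at by blast
      show ?thesis
      proof (cases l1)
        case (real r)
        then have "(f has_field_derivative r) (at x)"
          using l by (simp add: has_field_derivative_iff)
        then show ?thesis using x by (auto simp: real_differentiable_def)
      next
        case PInf
        then show ?thesis using l by (simp add: tendsto_PInfty)
      next
        case MInf
        have "eventually (\<lambda>y. q < ((0 - f y) - (0 - f x)) / (y - x)) (at x)" for q
        proof -
          have "eventually (\<lambda>y. ?s x y < - q) (at x)"
            using l MInf by (simp add: tendsto_MInfty)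
          then show ?thesis
          proof eventually_elim
            case (elim y)
            have "((0 - f y) - (0 - f x)) / (y - x) = - ?s x y"
              by (simp add: minus_divide_left)
            then show ?case using elim by linarith
          qed
        qed
        then show ?thesis by blast
      qed
    qed
  qed
  moreover have "countable (?C g)" for g :: "real \<Rightarrow> real"
    using countable_strict_local_minima by (intro countable_UN countable_rat)
  moreover have "countable (?P f \<union> ?P (\<lambda>x. 0 - f x))"
    by (intro countable_finite finite_UnI finite_infinite_slope f mf)
  ultimately have "countable ?N"
    by (meson countable_Un countable_subset)
  \<comment> \<open>Countability is upgraded to finiteness: \<open>?N\<close> is definable, so if
    infinite it would contain an interval.\<close>
  have "?N = {x. \<not> (\<exists>w. (f has_vector_derivative w) (at x))}"
    using vector_derivative_works differentiableI_vector by blast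
  also have "definable \<dots>"
    by (intro definable_intros definable_has_vector_derivative[where f = "\<lambda>_. f"] definable_map_comp[OF _ f])
  finally have "definable ?N" .
  moreover assume "infinite ?N"
  ultimately obtain c d where "c < d" "{c<..<d} \<subseteq> ?N"
    by (rule infinite_definable_contains_interval)
  then show False
    using \<open>countable ?N\<close> countable_subset uncountable_open_interval by metis
qed

lemma finite_nondifferentiable:
  fixes f :: "real \<Rightarrow> 'b::euclidean_space"
  assumes f: "definable_map f"
  shows "finite {x. \<not> f differentiable at x}"
proof -
  have "finite (\<Union>b\<in>Basis. {x. \<not> (\<lambda>y. f y \<bullet> b) differentiable at x})"
    by (intro finite_UN_I finite_Basis finite_nondifferentiable_real definable_map_component f)
  then show ?thesis
    by (rule finite_subset[rotated]) (auto simp: differentiable_componentwise_within[of f])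
qed


text \<open>Countably many finite sets cannot exhaust an interval, so some member of the cover is
  infinite inside it. This turns choices made separately at each parameter, of a rational vector or
  of a threshold, into a choice that is constant on a subinterval.\<close>

lemma countable_definable_cover_contains_interval:
  fixes E :: "'i \<Rightarrow> real set"
  assumes "c < d" "countable I" "{c<..<d} \<subseteq> (\<Union>i\<in>I. E i)" "\<And>i. i \<in> I \<Longrightarrow> definable (E i)"
  shows "\<exists>i\<in>I. \<exists>c' d'. c \<le> c' \<and> c' < d' \<and> d' \<le> d \<and> {c'<..<d'} \<subseteq> E i"
proof -
  let ?E = "\<lambda>i. {r. r \<in> E i \<and> c < r \<and> r < d}"
  have "\<exists>i\<in>I. infinite (?E i)"
  proof (rule ccontr)
    assume "\<not> ?thesis"
    then have "countable (\<Union>i\<in>I. ?E i)"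
      by (intro countable_UN assms countable_finite) auto
    then have "countable {c<..<d}" 
    proof (rule countable_subset[rotated], intro subsetI)
      fix r assume r: "r \<in> {c<..<d}"
      then obtain i where "i \<in> I" "r \<in> E i" using assms(3) by blast
      then show "r \<in> (\<Union>i\<in>I. ?E i)" using r by auto
    qed
    then show False using uncountable_open_interval assms(1) by blast
  qed
  then obtain i where i: "i \<in> I" "infinite (?E i)" by blast
  have "definable (?E i)"
    by (intro definable_intros definable_vimage[OF _ assms(4)[OF i(1)]])
  then obtain c' d' where cd: "c' < d'" "{c'<..<d'} \<subseteq> ?E i"
    using infinite_definable_contains_interval i(2) by blast
  then have "{c'<..<d'} \<subseteq> {c<..<d}" by auto
  then have "c \<le> c'" "d' \<le> d" using cd(1) by (auto simp: greaterThanLessThan_subseteq_greaterThanLessThan)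
  moreover have "{c'<..<d'} \<subseteq> E i" using cd(2) by auto
  ultimately show ?thesis using i(1) cd(1) by blast
qed

text \<open>Near \<open>\<delta> = 0\<close> one of the two sets contains the whole germ of the fibre over \<open>r\<close>; the length of
  the germ is made uniform by the countable covering argument.\<close>

lemma box_of_definable_cover:
  fixes A B :: "(real \<times> real) set"
  assumes A: "definable A" and B: "definable B" and cde: "c < d" "0 < e"
    and cover: "\<And>r \<delta>. c < r \<Longrightarrow> r < d \<Longrightarrow> 0 < \<delta> \<Longrightarrow> \<delta> < e \<Longrightarrow> (r, \<delta>) \<in> A \<union> B"
  shows "\<exists>C c' d' e'. (C = A \<or> C = B) \<and> c \<le> c' \<and> c' < d' \<and> d' \<le> d \<and> 0 < e' \<and> e' \<le> e \<and>
    {c'<..<d'} \<times> {0<..<e'} \<subseteq> C"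
proof -
  define E where "E = (\<lambda>(C :: (real \<times> real) set, k). {r. \<forall>\<delta>. 0 < \<delta> \<and> \<delta> < inverse (real (Suc k)) \<longrightarrow> (r, \<delta>) \<in> C})"
  have "{c<..<d} \<subseteq> (\<Union>i\<in>{A, B} \<times> UNIV. E i)"
  proof
    fix r assume r: "r \<in> {c<..<d}"
    have "definable {\<delta>. (r, \<delta>) \<in> A}" by (intro definable_intros definable_vimage[OF _ A])
    then have "eventually (\<lambda>\<delta>. (r, \<delta>) \<in> A) (at_right 0) \<or> eventually (\<lambda>\<delta>. (r, \<delta>) \<notin> A) (at_right 0)"
      by (rule definable_eventually_at_right)
    moreover have "eventually (\<lambda>\<delta>. 0 < \<delta> \<and> \<delta> < e) (at_right 0)"
      unfolding eventually_at_right_field using cde(2) by auto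
    then have AB: "eventually (\<lambda>\<delta>. (r, \<delta>) \<notin> A \<longrightarrow> (r, \<delta>) \<in> B) (at_right 0)"
      by eventually_elim (use cover[of r] r in auto)
    ultimately have "eventually (\<lambda>\<delta>. (r, \<delta>) \<in> A) (at_right 0) \<or> eventually (\<lambda>\<delta>. (r, \<delta>) \<in> B) (at_right 0)"
      using eventually_mp[OF AB] by blast
    then obtain C h where C: "C = A \<or> C = B" "0 < h" "\<And>\<delta>. 0 < \<delta> \<Longrightarrow> \<delta> < h \<Longrightarrow> (r, \<delta>) \<in> C"
      unfolding eventually_at_right_field by blast
    from reals_Archimedean[OF C(2)] obtain k where "inverse (real (Suc k)) < h" by blast
    then have "r \<in> E (C, k)" using C(3) by (auto simp: E_def)
    then show "r \<in> (\<Union>i\<in>{A, B} \<times> UNIV. E i)" using C(1) by blast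
  qed
  moreover have "definable (E i)" if "i \<in> {A, B} \<times> UNIV" for i
  proof -
    obtain C k where i: "i = (C, k)" "definable C" using \<open>i \<in> {A, B} \<times> UNIV\<close> A B by auto
    show ?thesis unfolding i(1) E_def prod.case by (intro definable_intros definable_vimage[OF _ i(2)])
  qed
  ultimately have "\<exists>i\<in>{A, B} \<times> UNIV. \<exists>c' d'. c \<le> c' \<and> c' < d' \<and> d' \<le> d \<and> {c'<..<d'} \<subseteq> E i"
    by (intro countable_definable_cover_contains_interval cde(1)) auto
  then obtain i c' d' where i: "i \<in> {A, B} \<times> UNIV" "c \<le> c'" "c' < d'" "d' \<le> d" "{c'<..<d'} \<subseteq> E i"
    by blast
  obtain C k where C: "i = (C, k)" by (cases i)
  show ?thesis
  proof (intro exI conjI)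
    show "C = A \<or> C = B" using i(1) C by auto
    show "{c'<..<d'} \<times> {0<..<min e (inverse (real (Suc k)))} \<subseteq> C"
      using i(5) C by (auto simp: E_def)
  qed (use i cde in auto)
qed

text \<open>For each coordinate the box lemma is applied twice, first to split off the points
  without a derivative and then to sort by the sign of the derivative. The form
  \<open>\<bar>l\<bar> = \<sigma> * l\<close> makes the absolute value linear with a constant factor
  on the whole box.\<close>

lemma derivative_sign_box:
  fixes f :: "'i \<Rightarrow> real \<times> real \<Rightarrow> real"
  assumes "finite B" "\<And>b. b \<in> B \<Longrightarrow> definable_map (f b)" "c < d" "0 < e"
  shows "\<exists>c' d' e'. c \<le> c' \<and> c' < d' \<and> d' \<le> d \<and> 0 < e' \<and> e' \<le> e \<and>
    (\<forall>b\<in>B. \<exists>\<sigma>. \<bar>\<sigma>\<bar> \<le> 1 \<and> (\<forall>r \<delta>. c' < r \<longrightarrow> r < d' \<longrightarrow> 0 < \<delta> \<longrightarrow> \<delta> < e' \<longrightarrow>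
      (\<exists>l. ((\<lambda>r. f b (r, \<delta>)) has_vector_derivative l) (at r) \<and> \<bar>l\<bar> = \<sigma> * l)))"
  using assms(1,2)
proof (induction B rule: finite_induct)
  case empty
  then show ?case using assms(3,4) by auto
next
  case (insert b B)
  from insert.IH insert.prems obtain c1 d1 e1 where 1: "c \<le> c1" "c1 < d1" "d1 \<le> d" "0 < e1" "e1 \<le> e"
    and B: "\<And>b. b \<in> B \<Longrightarrow> \<exists>\<sigma>. \<bar>\<sigma>\<bar> \<le> 1 \<and> (\<forall>r \<delta>. c1 < r \<longrightarrow> r < d1 \<longrightarrow> 0 < \<delta> \<longrightarrow> \<delta> < e1 \<longrightarrow>
      (\<exists>l. ((\<lambda>r. f b (r, \<delta>)) has_vector_derivative l) (at r) \<and> \<bar>l\<bar> = \<sigma> * l))"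
    by (auto simp: insert_iff)
  have f: "definable_map (f b)" using insert.prems by simp
  have f': "definable_map (\<lambda>z. f b (snd z, snd (fst z)))"
    by (intro definable_intros definable_map_comp[OF _ f])
  let ?D = "\<lambda>r \<delta> l. ((\<lambda>r. f b (r, \<delta>)) has_vector_derivative l) (at r)"
  have D: "definable {z. ?D (fst (fst z)) (snd (fst z)) (snd z)}"
    by (intro definable_has_vector_derivative definable_intros definable_map_comp[OF _ f])
  let ?N = "{z. \<not> (\<exists>l. ?D (fst z) (snd z) l)}"
  let ?P = "\<lambda>s. {z. \<exists>l. ?D (fst z) (snd z) l \<and> 0 \<le> s * l}"
  have N: "definable ?N" by (intro definable_intros D)
  have P: "definable (?P s)" for s by (intro definable_intros D)
  have "\<exists>C c2 d2 e2. (C = ?N \<or> C = ?P 1 \<union> ?P (-1)) \<and> c1 \<le> c2 \<and> c2 < d2 \<and> d2 \<le> d1 \<and> 0 < e2 \<and> e2 \<le> e1 \<and>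
      {c2<..<d2} \<times> {0<..<e2} \<subseteq> C"
  proof (rule box_of_definable_cover[OF N definable_Un[OF P[of 1] P[of "-1"]] 1(2,4)])
    fix r \<delta>
    show "(r, \<delta>) \<in> ?N \<union> (?P 1 \<union> ?P (-1))"
      by (cases "\<exists>l. ?D r \<delta> l") (auto, meson linear)
  qed
  then obtain c2 d2 e2 where 2: "c1 \<le> c2" "c2 < d2" "d2 \<le> d1" "0 < e2" "e2 \<le> e1"
    and "{c2<..<d2} \<times> {0<..<e2} \<subseteq> ?N \<or> {c2<..<d2} \<times> {0<..<e2} \<subseteq> ?P 1 \<union> ?P (-1)"
    by blast
  \<comment> \<open>A single slice, \<open>\<delta> = e2 / 2\<close>, rules out this alternative,
    since a definable function of one variable is differentiable outside a finite set.\<close>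
  moreover have "\<not> {c2<..<d2} \<times> {0<..<e2} \<subseteq> ?N"
  proof
    assume N: "{c2<..<d2} \<times> {0<..<e2} \<subseteq> ?N"
    have "definable_map (\<lambda>r. f b (r, e2 / 2))" by (intro definable_intros definable_map_comp[OF _ f])
    then have "finite {r. \<not> (\<lambda>r. f b (r, e2 / 2)) differentiable at r}" by (rule finite_nondifferentiable)
    moreover have "\<not> (\<lambda>r. f b (r, e2 / 2)) differentiable at r" if "c2 < r" "r < d2" for r
    proof
      assume "(\<lambda>r. f b (r, e2 / 2)) differentiable at r"
      then have "\<exists>l. ?D r (e2 / 2) l" using vector_derivative_works by blast
      moreover have "(r, e2 / 2) \<in> ?N" using N that 2(4) by (intro subsetD[OF N]) auto
      ultimately show False by simp
    qed
    then have "{c2<..<d2} \<subseteq> {r. \<not> (\<lambda>r. f b (r, e2 / 2)) differentiable at r}" by auto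
    ultimately have "finite {c2<..<d2}" using finite_subset by blast
    then show False using infinite_Ioo[OF 2(2)] by blast
  qed
  ultimately have P12: "{c2<..<d2} \<times> {0<..<e2} \<subseteq> ?P 1 \<union> ?P (-1)" by blast
  have "\<exists>C c3 d3 e3. (C = ?P 1 \<or> C = ?P (-1)) \<and> c2 \<le> c3 \<and> c3 < d3 \<and> d3 \<le> d2 \<and> 0 < e3 \<and> e3 \<le> e2 \<and>
      {c3<..<d3} \<times> {0<..<e3} \<subseteq> C"
  proof (rule box_of_definable_cover[OF P[of 1] P[of "-1"] 2(2,4)])
    show "(r, \<delta>) \<in> ?P 1 \<union> ?P (-1)" if "c2 < r" "r < d2" "0 < \<delta>" "\<delta> < e2" for r \<delta>
      by (rule subsetD[OF P12]) (use that in auto)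
  qed
  then obtain C c3 d3 e3 where 3: "c2 \<le> c3" "c3 < d3" "d3 \<le> d2" "0 < e3" "e3 \<le> e2"
    and C: "C = ?P 1 \<or> C = ?P (-1)" "{c3<..<d3} \<times> {0<..<e3} \<subseteq> C"
    by blast
  from C(1) obtain s :: real where s1: "\<bar>s\<bar> = 1" and "C = ?P s"
  proof
    assume "C = ?P 1" then show ?thesis by (rule that[rotated]) simp
  next
    assume "C = ?P (-1)" then show ?thesis by (rule that[rotated]) simp
  qed
  with C(2) have s: "{c3<..<d3} \<times> {0<..<e3} \<subseteq> ?P s" by simp
  show ?case
  proof (rule exI[of _ c3], rule exI[of _ d3], rule exI[of _ e3], intro conjI ballI)
    show "c \<le> c3" "c3 < d3" "d3 \<le> d" "0 < e3" "e3 \<le> e" using 1 2 3 by auto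
    fix b' assume b': "b' \<in> insert b B"
    show "\<exists>\<sigma>. \<bar>\<sigma>\<bar> \<le> 1 \<and> (\<forall>r \<delta>. c3 < r \<longrightarrow> r < d3 \<longrightarrow> 0 < \<delta> \<longrightarrow> \<delta> < e3 \<longrightarrow>
      (\<exists>l. ((\<lambda>r. f b' (r, \<delta>)) has_vector_derivative l) (at r) \<and> \<bar>l\<bar> = \<sigma> * l))"
    proof (cases "b' = b")
      case True
      have "\<exists>l. ?D r \<delta> l \<and> \<bar>l\<bar> = s * l" if "c3 < r" "r < d3" "0 < \<delta>" "\<delta> < e3" for r \<delta>
      proof -
        have "(r, \<delta>) \<in> ?P s" using that by (intro subsetD[OF s]) auto
        then obtain l where "?D r \<delta> l" "0 \<le> s * l" by auto
        moreover from this have "\<bar>l\<bar> = s * l" using s1 by (metis abs_mult abs_of_nonneg mult_1)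
        ultimately show ?thesis by blast
      qed
      then show ?thesis using True s1 by (intro exI[of _ s]) auto
    next
      case False
      then have "b' \<in> B" using b' by simp
      from B[OF this] obtain \<sigma> where "\<bar>\<sigma>\<bar> \<le> 1" "\<And>r \<delta>. c1 < r \<Longrightarrow> r < d1 \<Longrightarrow> 0 < \<delta> \<Longrightarrow> \<delta> < e1 \<Longrightarrow>
        (\<exists>l. ((\<lambda>r. f b' (r, \<delta>)) has_vector_derivative l) (at r) \<and> \<bar>l\<bar> = \<sigma> * l)" by blast
      then show ?thesis using 2 3 by (intro exI[of _ \<sigma>]) auto
    qed
  qed
qed

end

section \<open>Normals along definable curves\<close>

text \<open>A first-order form of the Frechet normal cone; it makes sense for \<open>p \<notin> Q\<close> too.\<close>

definition epsilon_normal :: "'a::euclidean_space set \<Rightarrow> 'a \<Rightarrow> 'a \<Rightarrow> bool" where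
  "epsilon_normal Q p v \<longleftrightarrow>
     (\<forall>c. 0 < c \<longrightarrow> (\<exists>h. 0 < h \<and> (\<forall>q. q \<in> Q \<and> norm (q - p) < h \<longrightarrow> v \<bullet> (q - p) \<le> c * norm (q - p))))"

lemma frechet_normal_cone_imp_epsilon_normal:
  assumes "v \<in> frechet_normal_cone Q p"
  shows "epsilon_normal Q p v"
  unfolding epsilon_normal_def
proof (intro allI impI)
  fix c :: real assume c: "0 < c"
  obtain w where w: "\<And>x. x \<in> Q \<Longrightarrow> v \<bullet> (x - p) \<le> w x"
    and lim: "((\<lambda>x. w x / norm (x - p)) \<longlongrightarrow> 0) (at p within Q)"
    using assms unfolding frechet_normal_cone_def by auto
  obtain h where h: "h > 0" "\<And>x. x \<in> Q \<Longrightarrow> x \<noteq> p \<Longrightarrow> dist x p < h \<Longrightarrow> w x / norm (x - p) < c"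
    using order_tendstoD(2)[OF lim c] unfolding eventually_at by auto
  have "v \<bullet> (q - p) \<le> c * norm (q - p)" if q: "q \<in> Q" "norm (q - p) < h" for q
  proof (cases "q = p")
    case False
    then have "w q / norm (q - p) < c" using h(2) q by (simp add: dist_norm)
    then have "w q < c * norm (q - p)" using False by (simp add: divide_simps split: if_splits)
    then show ?thesis using w[OF q(1)] by simp
  qed simp
  then show "\<exists>h. 0 < h \<and> (\<forall>q. q \<in> Q \<and> norm (q - p) < h \<longrightarrow> v \<bullet> (q - p) \<le> c * norm (q - p))"
    using h(1) by blast
qed

lemma has_vector_derivative_imp_slope_tendsto:
  fixes \<gamma> :: "real \<Rightarrow> 'a::real_normed_vector"
  assumes "(\<gamma> has_vector_derivative g) (at t)"
  shows "((\<lambda>y. (\<gamma> y - \<gamma> t) /\<^sub>R (y - t)) \<longlongrightarrow> g) (at t)"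
proof -
  have "((\<lambda>y. ((\<gamma> y - \<gamma> t) - (y - t) *\<^sub>R g) /\<^sub>R norm (y - t)) \<longlongrightarrow> 0) (at t)"
    using assms unfolding has_vector_derivative_def has_derivative_at_within by blast
  then have "((\<lambda>y. norm (((\<gamma> y - \<gamma> t) - (y - t) *\<^sub>R g) /\<^sub>R norm (y - t))) \<longlongrightarrow> 0) (at t)"
    by (rule tendsto_norm_zero)
  moreover have "eventually (\<lambda>y. norm (((\<gamma> y - \<gamma> t) - (y - t) *\<^sub>R g) /\<^sub>R norm (y - t))
      = norm ((\<gamma> y - \<gamma> t) /\<^sub>R (y - t) - g)) (at t)"
  proof -
    have "norm (((\<gamma> y - \<gamma> t) - (y - t) *\<^sub>R g) /\<^sub>R norm (y - t)) = norm ((\<gamma> y - \<gamma> t) /\<^sub>R (y - t) - g)"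
      if "y \<noteq> t" for y
    proof -
      have "(\<gamma> y - \<gamma> t) - (y - t) *\<^sub>R g = (y - t) *\<^sub>R ((\<gamma> y - \<gamma> t) /\<^sub>R (y - t) - g)"
        using that by (simp add: scaleR_diff_right)
      then show ?thesis using that by (simp add: abs_mult)
    qed
    then show ?thesis by (simp add: eventually_at_filter)
  qed
  ultimately have "((\<lambda>y. norm ((\<gamma> y - \<gamma> t) /\<^sub>R (y - t) - g)) \<longlongrightarrow> 0) (at t)"
    by (rule Lim_transform_eventually)
  then show ?thesis by (simp add: Lim_null[of _ g] tendsto_norm_zero_iff)
qed

text \<open>The normal inequality is tested along the curve on both sides of \<open>t\<close>. The
  two one-sided limits bound \<open>v \<bullet> g\<close> and its negative by an arbitrarily small
  multiple of \<open>norm g\<close>.\<close>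

lemma epsilon_normal_orthogonal_curve:
  fixes \<gamma> :: "real \<Rightarrow> 'a::euclidean_space"
  assumes v: "epsilon_normal Q (\<gamma> t) v"
    and \<gamma>: "(\<gamma> has_vector_derivative g) (at t)"
    and Q: "eventually (\<lambda>y. \<gamma> y \<in> Q) (at t)"
  shows "v \<bullet> g = 0"
proof (rule ccontr)
  let ?d = "\<lambda>y. (\<gamma> y - \<gamma> t) /\<^sub>R (y - t)"
  assume "v \<bullet> g \<noteq> 0"
  then have pos: "0 < \<bar>v \<bullet> g\<bar>" by simp
  \<comment> \<open>Chosen so that \<open>c * norm g < \<bar>v \<bullet> g\<bar>\<close>, which
    contradicts the bound derived below.\<close>
  define c where "c = \<bar>v \<bullet> g\<bar> / (2 * (norm g + 1))"
  have c: "0 < c" unfolding c_def using pos by (simp add: add_nonneg_pos)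
  obtain h where h: "0 < h" "\<And>q. q \<in> Q \<Longrightarrow> norm (q - \<gamma> t) < h \<Longrightarrow> v \<bullet> (q - \<gamma> t) \<le> c * norm (q - \<gamma> t)"
    using v c unfolding epsilon_normal_def by meson
  have "(\<gamma> \<longlongrightarrow> \<gamma> t) (at t)"
    using has_vector_derivative_continuous[OF \<gamma>] by (simp add: continuous_at)
  then have "eventually (\<lambda>y. norm (\<gamma> y - \<gamma> t) < h) (at t)"
    using h(1) by (auto dest: tendstoD simp: dist_norm)
  with Q have ev: "eventually (\<lambda>y. v \<bullet> (\<gamma> y - \<gamma> t) \<le> c * norm (\<gamma> y - \<gamma> t)) (at t)"
    by eventually_elim (rule h(2))
  have lim: "(?d \<longlongrightarrow> g) (at t)"
    by (rule has_vector_derivative_imp_slope_tendsto[OF \<gamma>])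
  \<comment> \<open>Here \<open>s\<close> is the sign of \<open>y - t\<close> on the one-sided
    filter \<open>F\<close>.\<close>
  have bound: "s * (v \<bullet> g) \<le> c * norm g"
    if F: "F \<le> at t" "F \<noteq> bot" and s: "eventually (\<lambda>y. s * \<bar>y - t\<bar> = y - t) F" "\<bar>s\<bar> = 1" for F and s :: real
  proof (rule tendsto_le[OF F(2)])
    have lim': "(?d \<longlongrightarrow> g) F" by (rule tendsto_mono[OF F(1) lim])
    show "((\<lambda>y. c * norm (?d y)) \<longlongrightarrow> c * norm g) F" by (intro tendsto_intros lim')
    show "((\<lambda>y. s * (v \<bullet> ?d y)) \<longlongrightarrow> s * (v \<bullet> g)) F" by (intro tendsto_intros lim')
    have "eventually (\<lambda>y. y \<noteq> t) F" using F(1) by (rule filter_leD) (simp add: eventually_at_filter)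
    with filter_leD[OF F(1) ev] s(1) show "eventually (\<lambda>y. s * (v \<bullet> ?d y) \<le> c * norm (?d y)) F"
    proof eventually_elim
      case (elim y)
      have "s = 1 \<or> s = -1" using s(2) by (auto simp: abs_if split: if_splits)
      then have "s * inverse (y - t) = inverse \<bar>y - t\<bar>"
        using elim(2) by (elim disjE) (simp_all, metis inverse_minus_eq minus_diff_eq)
      then have "s * (v \<bullet> ?d y) = (v \<bullet> (\<gamma> y - \<gamma> t)) / \<bar>y - t\<bar>"
        by (simp add: divide_inverse mult.assoc[symmetric] mult.commute)
      also have "\<dots> \<le> c * norm (\<gamma> y - \<gamma> t) / \<bar>y - t\<bar>"
        using elim(1) by (intro divide_right_mono) auto
      also have "\<dots> = c * norm (?d y)" by (simp add: divide_inverse mult.commute)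
      finally show ?case .
    qed
  qed
  have "1 * (v \<bullet> g) \<le> c * norm g"
  proof (rule bound[of "at_right t"])
    show "at_right t \<le> at t" by (rule at_le) simp
  qed (simp_all add: eventually_at_filter)
  moreover have "(-1) * (v \<bullet> g) \<le> c * norm g"
  proof (rule bound[of "at_left t"])
    show "at_left t \<le> at t" by (rule at_le) simp
  qed (simp_all add: eventually_at_filter)
  ultimately have "\<bar>v \<bullet> g\<bar> \<le> c * norm g" by auto
  also have "norm g < 2 * (norm g + 1)" using norm_ge_zero[of g] by (simp add: distrib_left add_nonneg_pos)
  then have "c * norm g < c * (2 * (norm g + 1))" using c by simp
  also have "\<dots> = \<bar>v \<bullet> g\<bar>" 
  proof -
    have "2 * (norm g + 1) \<noteq> 0" using norm_ge_zero[of g] by (simp add: add_nonneg_eq_0_iff)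
    then show ?thesis unfolding c_def by (metis nonzero_eq_divide_eq)
  qed
  finally show False by simp
qed

text \<open>For vectors whose coordinates have prescribed signs this norm is linear, so an estimate
  by it for the velocities of a curve with monotone coordinates integrates to the same estimate for
  the increments.\<close>

abbreviation l1_norm :: "'a::euclidean_space \<Rightarrow> real" where
  "l1_norm x \<equiv> \<Sum>b\<in>Basis. \<bar>x \<bullet> b\<bar>"

text \<open>A stand-in for the existence of a limiting normal at \<open>q\<close> within
  \<open>\<eta>\<close> of \<open>n\<close>. It avoids sequences, over which a first-order formula
  cannot quantify.\<close>

definition nearly_normal :: "'a::euclidean_space set \<Rightarrow> 'a \<Rightarrow> 'a \<Rightarrow> real \<Rightarrow> bool" where
  "nearly_normal Q q n \<eta> \<longleftrightarrow> (\<forall>\<delta>. 0 < \<delta> \<longrightarrow> (\<exists>p. p \<in> Q \<and> norm (p - q) < \<delta> \<and>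
     (\<exists>v. epsilon_normal Q p v \<and> norm (v - n) \<le> \<eta>)))"

text \<open>Some limiting normal at \<open>q\<close> is not orthogonal to \<open>g\<close>; the margin given by \<open>\<eta>\<close> allows \<open>n\<close> and \<open>\<eta>\<close> to
  be taken from a countable set.\<close>

definition transversal :: "'a::euclidean_space set \<Rightarrow> 'a \<Rightarrow> 'a \<Rightarrow> bool" where
  "transversal Q q g \<longleftrightarrow> (\<exists>n \<eta>. 0 < \<eta> \<and> \<eta> * l1_norm g < \<bar>n \<bullet> g\<bar> \<and> nearly_normal Q q n \<eta>)"

text \<open>Enlarging the tolerance absorbs a small change of the vector: the ball of radius
  \<open>\<mu>\<close> about \<open>m\<close> lies in the ball of radius \<open>\<eta>\<close> about
  \<open>n\<close>. The pairs \<open>(n, \<eta>)\<close> that allow this and keep the strict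
  inequality form a nonempty open set, which meets \<open>D\<close>.\<close>

lemma transversal_rational:
  fixes D :: "('a::euclidean_space \<times> real) set"
  assumes D: "\<And>X. open X \<Longrightarrow> X \<noteq> {} \<Longrightarrow> \<exists>d\<in>D. d \<in> X" and t: "transversal Q q g"
  shows "\<exists>(n, \<eta>)\<in>D. 0 < \<eta> \<and> \<eta> * l1_norm g < \<bar>n \<bullet> g\<bar> \<and> nearly_normal Q q n \<eta>"
proof -
  obtain m \<mu> where m: "0 < \<mu>" "\<mu> * l1_norm g < \<bar>m \<bullet> g\<bar>" "nearly_normal Q q m \<mu>"
    using t unfolding transversal_def by blast
  let ?X = "{z. norm (fst z - m) < snd z - \<mu> \<and> snd z * l1_norm g < \<bar>fst z \<bullet> g\<bar>}"
  have "open ?X"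
    by (intro open_Collect_conj open_Collect_less continuous_intros)
  moreover have "?X \<noteq> {}"
  proof -
    \<comment> \<open>An increase of the tolerance by \<open>s\<close> costs
      \<open>s * l1_norm g\<close>; the summand 1 in the denominator makes this strictly less than
      the available margin.\<close>
    define s where "s = (\<bar>m \<bullet> g\<bar> - \<mu> * l1_norm g) / (l1_norm g + 1)"
    have L: "0 \<le> l1_norm g" by (intro sum_nonneg) auto
    then have s: "0 < s" unfolding s_def using m(2) by (intro divide_pos_pos) linarith+
    have "s * l1_norm g < s * (l1_norm g + 1)" using s by simp
    also have "\<dots> = \<bar>m \<bullet> g\<bar> - \<mu> * l1_norm g" unfolding s_def using L by (subst times_divide_eq_left) (simp add: add_nonneg_eq_0_iff)
    finally have "(m, \<mu> + s) \<in> ?X" using s by (simp add: algebra_simps)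
    then show ?thesis by blast
  qed
  ultimately obtain z where z: "z \<in> D" "z \<in> ?X" using D by blast
  obtain n \<eta> where n: "z = (n, \<eta>)" by (cases z)
  have nm: "norm (n - m) < \<eta> - \<mu>" "\<eta> * l1_norm g < \<bar>n \<bullet> g\<bar>" using z n by auto
  have "norm (v - n) \<le> \<eta>" if "norm (v - m) \<le> \<mu>" for v
    using that nm(1) norm_triangle_ineq4[of "v - m" "n - m"] by simp
  then have "nearly_normal Q q n \<eta>" using m(3) unfolding nearly_normal_def by blast
  moreover have "0 < \<eta>" using nm(1) m(1) norm_ge_zero[of "n - m"] by linarith
  ultimately show ?thesis using z(1) n nm(2) by (intro bexI[of _ z]) auto
qed

lemma (in o_minimal_real_field) definable_epsilon_normal:
  assumes Q: "definable Q" and p: "definable_map p" and v: "definable_map v"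
  shows "definable {x. epsilon_normal Q (p x) (v x)}"
  unfolding epsilon_normal_def
  by (intro definable_intros definable_vimage[OF _ Q] definable_map_comp[OF _ p] definable_map_comp[OF _ v])

lemma (in o_minimal_real_field) definable_nearly_normal:
  assumes Q: "definable Q" and q: "definable_map q" and n: "definable_map n" and \<eta>: "definable_map \<eta>"
  shows "definable {x. nearly_normal Q (q x) (n x) (\<eta> x)}"
  unfolding nearly_normal_def
  by (intro definable_intros definable_vimage[OF _ Q] definable_epsilon_normal Q
      definable_map_comp[OF _ q] definable_map_comp[OF _ n] definable_map_comp[OF _ \<eta>])

lemma (in o_minimal_real_field) definable_transversal:
  assumes Q: "definable Q" and q: "definable_map q" and g: "definable_map g"
  shows "definable {x. transversal Q (q x) (g x)}"
  unfolding transversal_def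
  by (intro definable_intros definable_nearly_normal Q definable_map_comp[OF _ q] definable_map_comp[OF _ g])

context o_minimal_real_field
begin

text \<open>The approximating points \<open>p (r, \<delta>)\<close> converge to \<open>z r\<close>
  with \<open>\<delta>\<close>, but their velocities need not converge. The conclusion therefore
  concerns increments, and the limit is taken only after the infinitesimal estimate has been
  integrated for each fixed \<open>\<delta>\<close>.\<close>

lemma nearly_normal_curve_bound:
  fixes z :: "real \<Rightarrow> 'a::euclidean_space"
  assumes Q: "definable Q" and z: "definable_map z" and cd: "c < d" and \<eta>: "0 < \<eta>"
    and nn: "\<And>r. c < r \<Longrightarrow> r < d \<Longrightarrow> nearly_normal Q (z r) n \<eta>"
  shows "\<exists>c' d'. c \<le> c' \<and> c' < d' \<and> d' \<le> d \<and>
    (\<forall>s t. c' < s \<and> s < t \<and> t < d' \<longrightarrow> \<bar>n \<bullet> (z t - z s)\<bar> \<le> \<eta> * l1_norm (z t - z s))"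
proof -
  let ?X = "{w. snd w \<in> Q \<and> norm (snd w - z (fst (fst w))) < snd (fst w) \<and>
     (\<exists>v. epsilon_normal Q (snd w) v \<and> norm (v - n) \<le> \<eta>)}"
  have "definable ?X"
    by (intro definable_intros definable_vimage[OF _ Q] definable_map_comp[OF _ z] definable_epsilon_normal Q)
  from definable_choice[OF this] obtain p where p: "definable_map p"
    and p': "\<forall>x y. (x, y) \<in> ?X \<longrightarrow> (x, p x) \<in> ?X"
    by blast
  have pX: "p (r, \<delta>) \<in> Q" "norm (p (r, \<delta>) - z r) < \<delta>"
      "\<exists>v. epsilon_normal Q (p (r, \<delta>)) v \<and> norm (v - n) \<le> \<eta>"
    if r: "c < r" "r < d" "0 < \<delta>" for r \<delta>
  proof -
    obtain y where "y \<in> Q" "norm (y - z r) < \<delta>" "\<exists>v. epsilon_normal Q y v \<and> norm (v - n) \<le> \<eta>"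
      using nn[OF r(1,2)] r(3) unfolding nearly_normal_def by blast
    then have "((r, \<delta>), y) \<in> ?X" by simp
    from p'[rule_format, OF this] show "p (r, \<delta>) \<in> Q" "norm (p (r, \<delta>) - z r) < \<delta>"
      "\<exists>v. epsilon_normal Q (p (r, \<delta>)) v \<and> norm (v - n) \<le> \<eta>" by simp_all
  qed
  have "definable_map (\<lambda>x. p x \<bullet> b)" for b by (intro definable_intros p)
  from derivative_sign_box[where f = "\<lambda>b x. p x \<bullet> b", OF finite_Basis this cd zero_less_one]
  obtain c' d' e where cde: "c \<le> c'" "c' < d'" "d' \<le> d" "0 < e"
    and box: "\<And>b. b \<in> Basis \<Longrightarrow> \<exists>\<sigma>. \<bar>\<sigma>\<bar> \<le> 1 \<and> (\<forall>r \<delta>. c' < r \<longrightarrow> r < d' \<longrightarrow> 0 < \<delta> \<longrightarrow> \<delta> < e \<longrightarrow>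
      (\<exists>l. ((\<lambda>r. p (r, \<delta>) \<bullet> b) has_vector_derivative l) (at r) \<and> \<bar>l\<bar> = \<sigma> * l))"
    by blast
  from box obtain \<sigma> where \<sigma>: "\<And>b. b \<in> Basis \<Longrightarrow> \<bar>\<sigma> b\<bar> \<le> 1"
    and deriv: "\<And>b r \<delta>. b \<in> Basis \<Longrightarrow> c' < r \<Longrightarrow> r < d' \<Longrightarrow> 0 < \<delta> \<Longrightarrow> \<delta> < e \<Longrightarrow>
      (\<exists>l. ((\<lambda>r. p (r, \<delta>) \<bullet> b) has_vector_derivative l) (at r) \<and> \<bar>l\<bar> = \<sigma> b * l)"
    by metis
  have bound: "\<bar>n \<bullet> (p (t, \<delta>) - p (s, \<delta>))\<bar> \<le> \<eta> * l1_norm (p (t, \<delta>) - p (s, \<delta>))"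
    if st: "c' < s" "s < t" "t < d'" and \<delta>: "0 < \<delta>" "\<delta> < e" for s t \<delta>
  proof -
    let ?\<gamma> = "\<lambda>r. p (r, \<delta>)"
    \<comment> \<open>With \<open>g\<close> the velocity of \<open>?\<gamma>\<close>, the derivative
      of \<open>?h k\<close> is \<open>\<eta> * l1_norm g - k * (n \<bullet> g)\<close>. It is
      nonnegative because \<open>n \<bullet> g = (n - v) \<bullet> g\<close> for a normal
      \<open>v\<close> within \<open>\<eta>\<close> of \<open>n\<close>. The values 1 and -1 of
      \<open>k\<close> together bound the absolute value.\<close>
    let ?h = "\<lambda>k r. \<eta> * (\<Sum>b\<in>Basis. \<sigma> b * (?\<gamma> r \<bullet> b)) - k * (n \<bullet> ?\<gamma> r)"
    have mono: "?h k s \<le> ?h k t" if k: "\<bar>k\<bar> = 1" for k :: real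
    proof (rule DERIV_nonneg_imp_nondecreasing[where f = "?h k"])
      fix r assume r: "s \<le> r" "r \<le> t"
      then have r': "c' < r" "r < d'" "c < r" "r < d" using st cde by auto
      from deriv[OF _ r'(1,2) \<delta>] obtain l where
        l: "\<And>b. b \<in> Basis \<Longrightarrow> ((\<lambda>r. ?\<gamma> r \<bullet> b) has_vector_derivative l b) (at r)"
           "\<And>b. b \<in> Basis \<Longrightarrow> \<bar>l b\<bar> = \<sigma> b * l b"
        by metis
      define g where "g = (\<Sum>b\<in>Basis. l b *\<^sub>R b)"
      have gb: "g \<bullet> b = l b" if "b \<in> Basis" for b
        using that by (simp add: g_def inner_sum_left_Basis)
      have "((\<lambda>r. \<Sum>b\<in>Basis. (?\<gamma> r \<bullet> b) *\<^sub>R b) has_vector_derivative g) (at r)"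
        unfolding g_def
        by (intro has_vector_derivative_sum bounded_linear.has_vector_derivative[OF bounded_linear_scaleR_left] l(1))
      then have g: "(?\<gamma> has_vector_derivative g) (at r)" by (simp add: euclidean_representation)
      obtain v where v: "epsilon_normal Q (?\<gamma> r) v" "norm (v - n) \<le> \<eta>"
        using pX(3)[OF r'(3,4) \<delta>(1)] by blast
      have "eventually (\<lambda>r. r \<in> {c<..<d}) (at r)"
        using r' by (intro eventually_at_in_open') auto
      then have "eventually (\<lambda>r. ?\<gamma> r \<in> Q) (at r)"
        by eventually_elim (use pX(1) \<delta>(1) in auto)
      from epsilon_normal_orthogonal_curve[OF v(1) g this] have "n \<bullet> g = (n - v) \<bullet> g"
        by (simp add: inner_diff_left)
      then have "k * (n \<bullet> g) \<le> norm (n - v) * norm g"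
        using Cauchy_Schwarz_ineq2[of "n - v" g] k by (auto simp: abs_if split: if_splits)
      also have "\<dots> \<le> \<eta> * l1_norm g"
        using v(2) \<eta> norm_le_l1[of g] by (intro mult_mono) (auto simp: norm_minus_commute)
      finally have le: "0 \<le> \<eta> * (\<Sum>b\<in>Basis. \<sigma> b * l b) - k * (n \<bullet> g)"
        using gb l(2) by simp
      have "(?h k has_real_derivative \<eta> * (\<Sum>b\<in>Basis. \<sigma> b * l b) - k * (n \<bullet> g)) (at r)"
      proof -
        have "((\<lambda>r. n \<bullet> ?\<gamma> r) has_real_derivative n \<bullet> g) (at r)"
          unfolding has_real_derivative_iff_has_vector_derivative
          by (rule bounded_linear.has_vector_derivative[OF bounded_linear_inner_right g])
        moreover have "((\<lambda>r. ?\<gamma> r \<bullet> b) has_real_derivative l b) (at r)" if "b \<in> Basis" for b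
          using l(1)[OF that] by (simp add: has_real_derivative_iff_has_vector_derivative)
        ultimately show ?thesis by (intro DERIV_diff DERIV_cmult DERIV_sum) auto
      qed
      then show "\<exists>y. (?h k has_real_derivative y) (at r) \<and> 0 \<le> y" using le by blast
    qed (use st in simp)
    have "k * (n \<bullet> (?\<gamma> t - ?\<gamma> s)) \<le> \<eta> * (\<Sum>b\<in>Basis. \<sigma> b * ((?\<gamma> t - ?\<gamma> s) \<bullet> b))" if "\<bar>k\<bar> = 1" for k :: real
      using mono[OF that] by (simp add: inner_diff_left inner_diff_right right_diff_distrib sum_subtractf)
    from this[of 1] this[of "-1"]
    have "\<bar>n \<bullet> (?\<gamma> t - ?\<gamma> s)\<bar> \<le> \<eta> * (\<Sum>b\<in>Basis. \<sigma> b * ((?\<gamma> t - ?\<gamma> s) \<bullet> b))" by auto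
    also have "\<dots> \<le> \<eta> * l1_norm (?\<gamma> t - ?\<gamma> s)"
    proof (intro mult_left_mono sum_mono)
      fix b :: 'a assume "b \<in> Basis"
      then have "\<sigma> b * x \<le> \<bar>x\<bar>" for x
        using \<sigma>[of b] abs_ge_self[of "\<sigma> b * x"] mult_right_mono[of "\<bar>\<sigma> b\<bar>" 1 "\<bar>x\<bar>"] by (simp add: abs_mult)
      then show "\<sigma> b * ((?\<gamma> t - ?\<gamma> s) \<bullet> b) \<le> \<bar>(?\<gamma> t - ?\<gamma> s) \<bullet> b\<bar>" .
    qed (use \<eta> in simp)
    finally show ?thesis .
  qed
  have lim: "((\<lambda>\<delta>. p (r, \<delta>)) \<longlongrightarrow> z r) (at_right 0)" if "c < r" "r < d" for r
  proof -
    have "((\<lambda>\<delta>. p (r, \<delta>) - z r) \<longlongrightarrow> 0) (at_right 0)"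
    proof (rule Lim_null_comparison)
      show "((\<lambda>\<delta>::real. \<delta>) \<longlongrightarrow> 0) (at_right 0)" by (rule tendsto_ident_at)
      have "eventually (\<lambda>\<delta>::real. 0 < \<delta>) (at_right 0)" by (simp add: eventually_at_filter)
      then show "eventually (\<lambda>\<delta>. norm (p (r, \<delta>) - z r) \<le> \<delta>) (at_right 0)"
        by eventually_elim (use pX(2)[OF that] in \<open>auto intro: less_imp_le\<close>)
    qed
    then show ?thesis by (simp add: Lim_null[of _ "z r"])
  qed
  have "\<bar>n \<bullet> (z t - z s)\<bar> \<le> \<eta> * l1_norm (z t - z s)" if st: "c' < s" "s < t" "t < d'" for s t
  proof (rule tendsto_le)
    have s: "((\<lambda>\<delta>. p (s, \<delta>)) \<longlongrightarrow> z s) (at_right 0)" and t: "((\<lambda>\<delta>. p (t, \<delta>)) \<longlongrightarrow> z t) (at_right 0)"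
      using st cde by (auto intro!: lim)
    show "((\<lambda>\<delta>. \<eta> * l1_norm (p (t, \<delta>) - p (s, \<delta>))) \<longlongrightarrow> \<eta> * l1_norm (z t - z s)) (at_right 0)"
      by (intro tendsto_intros s t)
    show "((\<lambda>\<delta>. \<bar>n \<bullet> (p (t, \<delta>) - p (s, \<delta>))\<bar>) \<longlongrightarrow> \<bar>n \<bullet> (z t - z s)\<bar>) (at_right 0)"
      by (intro tendsto_intros s t)
    have "eventually (\<lambda>\<delta>. 0 < \<delta> \<and> \<delta> < e) (at_right 0)"
      unfolding eventually_at_right_field using cde(4) by auto
    then show "eventually (\<lambda>\<delta>. \<bar>n \<bullet> (p (t, \<delta>) - p (s, \<delta>))\<bar> \<le> \<eta> * l1_norm (p (t, \<delta>) - p (s, \<delta>))) (at_right 0)"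
      by eventually_elim (use bound[OF st] in auto)
  qed simp
  then show ?thesis using cde by blast
qed

text \<open>Countably many pairs \<open>(n, \<eta>)\<close> witness all transversal velocities, so
  one pair would serve a whole interval. There the bound on the increments contradicts the strict
  margin of that pair. Parameters without a velocity are finite in number anyway.\<close>

lemma finite_transversal_velocity:
  fixes z :: "real \<Rightarrow> 'a::euclidean_space"
  assumes Q: "definable Q" and z: "definable_map z"
  shows "finite {r. \<not> (\<exists>g. (z has_vector_derivative g) (at r) \<and> \<not> transversal Q (z r) g)}"
proof -
  let ?T = "{r. \<exists>g. (z has_vector_derivative g) (at r) \<and> transversal Q (z r) g}"
  have hvd: "definable {w. (z has_vector_derivative snd w) (at (fst w))}"
    by (intro definable_has_vector_derivative[where f = "\<lambda>_. z"] definable_intros definable_map_comp[OF _ z])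
  have "finite ?T"
  proof (rule ccontr)
    have "definable {r. \<exists>g. (r, g) \<in> {w. (z has_vector_derivative snd w) (at (fst w))} \<and> transversal Q (z r) g}"
      by (intro definable_intros definable_vimage[OF _ hvd] definable_transversal Q definable_map_comp[OF _ z])
    then have "definable ?T" by simp
    moreover assume "infinite ?T"
    ultimately obtain c d where cd: "c < d" "{c<..<d} \<subseteq> ?T"
      by (rule infinite_definable_contains_interval)
    obtain D :: "('a \<times> real) set" where D: "countable D" "\<And>X. open X \<Longrightarrow> X \<noteq> {} \<Longrightarrow> \<exists>d\<in>D. d \<in> X"
      by (rule countable_dense_setE) blast
    define E where "E w = {r. 0 < snd w \<and> (\<exists>g. (z has_vector_derivative g) (at r) \<and>
        snd w * l1_norm g < \<bar>fst w \<bullet> g\<bar>) \<and> nearly_normal Q (z r) (fst w) (snd w)}" for w :: "'a \<times> real"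
    have "\<exists>w\<in>D. \<exists>c' d'. c \<le> c' \<and> c' < d' \<and> d' \<le> d \<and> {c'<..<d'} \<subseteq> E w"
    proof (rule countable_definable_cover_contains_interval[OF cd(1) D(1)])
      show "{c<..<d} \<subseteq> (\<Union>w\<in>D. E w)"
      proof
        fix r assume "r \<in> {c<..<d}"
        then obtain g where g: "(z has_vector_derivative g) (at r)" "transversal Q (z r) g"
          using cd(2) by blast
        from transversal_rational[OF D(2) this(2)] show "r \<in> (\<Union>w\<in>D. E w)"
          using g(1) unfolding E_def by fastforce
      qed
      have "definable {r. 0 < snd w \<and> (\<exists>g. (r, g) \<in> {w. (z has_vector_derivative snd w) (at (fst w))} \<and>
        snd w * l1_norm g < \<bar>fst w \<bullet> g\<bar>) \<and> nearly_normal Q (z r) (fst w) (snd w)}" for w :: "'a \<times> real"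
        by (intro definable_intros definable_vimage[OF _ hvd] definable_nearly_normal Q definable_map_comp[OF _ z])
      then show "definable (E w)" for w unfolding E_def by simp
    qed
    then obtain n \<eta> c1 d1 where 1: "c \<le> c1" "c1 < d1" "d1 \<le> d" and E: "{c1<..<d1} \<subseteq> E (n, \<eta>)" by force
    have "0 < \<eta>" using E 1(2) dense[OF 1(2)] unfolding E_def by fastforce
    have "nearly_normal Q (z r) n \<eta>" if "c1 < r" "r < d1" for r
      using subsetD[OF E, of r] that unfolding E_def by auto
    from nearly_normal_curve_bound[OF Q z 1(2) \<open>0 < \<eta>\<close> this]
    obtain c2 d2 where 2: "c1 \<le> c2" "c2 < d2" "d2 \<le> d1"
      and bound: "\<And>s t. c2 < s \<Longrightarrow> s < t \<Longrightarrow> t < d2 \<Longrightarrow> \<bar>n \<bullet> (z t - z s)\<bar> \<le> \<eta> * l1_norm (z t - z s)"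
      by blast
    obtain s where s: "c2 < s" "s < d2" using dense[OF 2(2)] by blast
    then have "s \<in> E (n, \<eta>)" using E 2 by (intro subsetD[OF E]) auto
    then obtain g where g: "(z has_vector_derivative g) (at s)" "\<eta> * l1_norm g < \<bar>n \<bullet> g\<bar>"
      unfolding E_def by auto
    \<comment> \<open>Both sides of \<open>bound\<close> are positively homogeneous, so division by
      \<open>t - s\<close> and the limit from the right turn increments into the velocity.\<close>
    have "\<bar>n \<bullet> g\<bar> \<le> \<eta> * l1_norm g"
    proof (rule tendsto_le)
      let ?d = "\<lambda>t. (z t - z s) /\<^sub>R (t - s)"
      have "at_right s \<le> at s" by (rule at_le) simp
      then have lim: "(?d \<longlongrightarrow> g) (at_right s)"
        by (rule tendsto_mono) (rule has_vector_derivative_imp_slope_tendsto[OF g(1)])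
      show "((\<lambda>t. \<eta> * l1_norm (?d t)) \<longlongrightarrow> \<eta> * l1_norm g) (at_right s)" by (intro tendsto_intros lim)
      show "((\<lambda>t. \<bar>n \<bullet> ?d t\<bar>) \<longlongrightarrow> \<bar>n \<bullet> g\<bar>) (at_right s)" by (intro tendsto_intros lim)
      have "eventually (\<lambda>t. s < t \<and> t < d2) (at_right s)"
        unfolding eventually_at_right_field using s(2) by auto
      then show "eventually (\<lambda>t. \<bar>n \<bullet> ?d t\<bar> \<le> \<eta> * l1_norm (?d t)) (at_right s)"
      proof eventually_elim
        case (elim t)
        have "\<bar>n \<bullet> ?d t\<bar> = inverse (t - s) * \<bar>n \<bullet> (z t - z s)\<bar>"
          using elim by (simp add: abs_mult)
        also have "\<dots> \<le> inverse (t - s) * (\<eta> * l1_norm (z t - z s))"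
          using bound[OF s(1), of t] elim by (intro mult_left_mono) auto
        also have "\<dots> = \<eta> * l1_norm (?d t)"
          using elim by (simp add: abs_mult sum_distrib_left mult.left_commute)
        finally show ?case .
      qed
    qed simp
    then show False using g(2) by simp
  qed
  then have "finite ({r. \<not> z differentiable at r} \<union> ?T)"
    using finite_nondifferentiable[OF z] by simp
  then show ?thesis
    by (rule finite_subset[rotated]) (use vector_derivative_works in blast)
qed

end

section \<open>An integrable bound for the velocities\<close>

lemma eventually_not_in_finite:
  fixes F :: "'a::t1_space set"
  assumes "finite F" shows "eventually (\<lambda>x. x \<notin> F) (at a within A)"
proof -
  have "eventually (\<lambda>x. \<forall>y\<in>F. x \<noteq> y) (at a within A)"
    using assms by (intro eventually_ball_finite ballI eventually_neq_at_within)
  then show ?thesis by (auto elim: eventually_mono)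
qed

text \<open>The function \<open>H r + 1 / (r - a)\<close> is nondecreasing, so \<open>H\<close>
  would have to tend to minus infinity at \<open>a\<close>.\<close>

lemma no_bounded_primitive_of_inverse_square:
  fixes H h :: "real \<Rightarrow> real"
  assumes "a < c"
    and deriv: "\<And>r. a < r \<Longrightarrow> r < c \<Longrightarrow> (H has_real_derivative h r) (at r)"
    and bound: "\<And>r. a < r \<Longrightarrow> r < c \<Longrightarrow> \<bar>H r\<bar> \<le> B"
    and ge: "\<And>r. a < r \<Longrightarrow> r < c \<Longrightarrow> 1 / (r - a)\<^sup>2 \<le> h r"
  shows False
proof -
  define d where "d = (a + c) / 2"
  have d: "a < d" "d < c" using assms(1) by (auto simp: d_def)
  \<comment> \<open>The size of \<open>K\<close> puts \<open>a + 1 / K\<close> to the left of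
    \<open>d\<close>, and makes the value \<open>K\<close> of \<open>1 / (r - a)\<close> there
    exceed \<open>1 / (d - a)\<close> by more than the total variation \<open>2 * B\<close> open to
    \<open>H\<close>.\<close>
  define K where "K = 2 * B + 1 / (d - a) + 1"
  have "0 \<le> B" using bound[OF d] by linarith
  then have K: "1 / (d - a) < K" "0 < K" using d by (auto simp: K_def add_nonneg_pos)
  let ?r = "a + 1 / K"
  have "1 / K < d - a" using K d by (simp add: divide_simps mult.commute split: if_splits)
  then have r: "a < ?r" "?r < d" using K by auto
  have "H ?r + 1 / (?r - a) \<le> H d + 1 / (d - a)"
  proof (rule DERIV_nonneg_imp_nondecreasing[where f = "\<lambda>r. H r + 1 / (r - a)"])
    fix s assume s: "?r \<le> s" "s \<le> d"
    then have s': "a < s" "s < c" using r d by linarith+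
    then have "((\<lambda>r. H r + 1 / (r - a)) has_real_derivative h s - 1 / (s - a)\<^sup>2) (at s)"
      by (auto intro!: derivative_eq_intros deriv simp: power2_eq_square)
    then show "\<exists>y. ((\<lambda>r. H r + 1 / (r - a)) has_real_derivative y) (at s) \<and> 0 \<le> y"
      using ge[OF s'] by (intro exI[of _ "h s - 1 / (s - a)\<^sup>2"]) simp
  qed (use r in simp)
  then have "H ?r + K \<le> H d + 1 / (d - a)" by simp
  moreover have "\<bar>H ?r\<bar> \<le> B" "\<bar>H d\<bar> \<le> B" using bound r d by auto
  ultimately show False unfolding K_def by linarith
qed

context o_minimal_real_field
begin

text \<open>The germ dichotomy is applied to the existence of a nonnegative derivative. Its negation
  also includes points without a derivative, where the claim is vacuous.\<close>

lemma eventually_derivative_sign: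
  fixes f :: "real \<Rightarrow> real"
  assumes f: "definable_map f"
  shows "\<exists>s. \<bar>s\<bar> = 1 \<and> eventually (\<lambda>r. \<forall>l. (f has_vector_derivative l) (at r) \<longrightarrow> \<bar>l\<bar> = s * l) (at_right a)"
proof -
  have hvd: "definable {w. (f has_vector_derivative snd w) (at (fst w))}"
    by (intro definable_has_vector_derivative[where f = "\<lambda>_. f"] definable_intros definable_map_comp[OF _ f])
  have "definable {r. \<exists>l. (r, l) \<in> {w. (f has_vector_derivative snd w) (at (fst w))} \<and> 0 \<le> l}"
    by (intro definable_intros definable_vimage[OF _ hvd])
  from definable_eventually_at_right[OF this, of a] show ?thesis
  proof
    assume "eventually (\<lambda>r. \<exists>l. (r, l) \<in> {w. (f has_vector_derivative snd w) (at (fst w))} \<and> 0 \<le> l) (at_right a)"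
    then have "eventually (\<lambda>r. \<forall>l. (f has_vector_derivative l) (at r) \<longrightarrow> \<bar>l\<bar> = 1 * l) (at_right a)"
      by eventually_elim (auto dest: vector_derivative_unique_at)
    then show ?thesis by (intro exI[of _ 1]) simp
  next
    assume "eventually (\<lambda>r. \<not> (\<exists>l. (r, l) \<in> {w. (f has_vector_derivative snd w) (at (fst w))} \<and> 0 \<le> l)) (at_right a)"
    then have "eventually (\<lambda>r. \<forall>l. (f has_vector_derivative l) (at r) \<longrightarrow> \<bar>l\<bar> = (-1) * l) (at_right a)"
      by eventually_elim (auto simp: not_le)
    then show ?thesis by (intro exI[of _ "-1"]) simp
  qed
qed

text \<open>A definable choice of the velocity is itself a definable map, hence differentiable
  outside a finite set and so continuous near \<open>a\<close>.\<close>

lemma definable_curve_derivative: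
  fixes x :: "real \<Rightarrow> 'b::euclidean_space"
  assumes x: "definable_map x"
  shows "\<exists>x' s. (\<forall>b\<in>Basis. \<bar>s b\<bar> = (1::real)) \<and> eventually (\<lambda>r. (x has_vector_derivative x' r) (at r) \<and>
    isCont x' r \<and> (\<forall>b\<in>Basis. \<bar>x' r \<bullet> b\<bar> = s b * (x' r \<bullet> b))) (at_right a)"
proof -
  have "definable {w. (x has_vector_derivative snd w) (at (fst w))}"
    by (intro definable_has_vector_derivative[where f = "\<lambda>_. x"] definable_intros definable_map_comp[OF _ x])
  from definable_choice[OF this] obtain x' where x': "definable_map x'"
    and x'_deriv: "\<And>r w. (x has_vector_derivative w) (at r) \<Longrightarrow> (x has_vector_derivative x' r) (at r)"
    by auto
  have "\<forall>b. \<exists>s. \<bar>s\<bar> = 1 \<and>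
      eventually (\<lambda>r. \<forall>l. ((\<lambda>r. x r \<bullet> b) has_vector_derivative l) (at r) \<longrightarrow> \<bar>l\<bar> = s * l) (at_right a)"
    by (intro allI eventually_derivative_sign definable_intros x)
  from choice[OF this] obtain s where s: "\<And>b. \<bar>s b\<bar> = (1::real)"
    and sign: "\<And>b. eventually (\<lambda>r. \<forall>l. ((\<lambda>r. x r \<bullet> b) has_vector_derivative l) (at r) \<longrightarrow> \<bar>l\<bar> = s b * l) (at_right a)"
    by blast
  have "eventually (\<lambda>r. \<forall>b\<in>Basis. \<forall>l. ((\<lambda>r. x r \<bullet> b) has_vector_derivative l) (at r) \<longrightarrow> \<bar>l\<bar> = s b * l) (at_right a)"
    by (intro eventually_ball_finite finite_Basis ballI sign)
  moreover have "eventually (\<lambda>r. r \<notin> {r. \<not> x differentiable at r}) (at_right a)"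
    "eventually (\<lambda>r. r \<notin> {r. \<not> x' differentiable at r}) (at_right a)"
    by (intro eventually_not_in_finite finite_nondifferentiable x x')+
  ultimately have "eventually (\<lambda>r. (x has_vector_derivative x' r) (at r) \<and>
    isCont x' r \<and> (\<forall>b\<in>Basis. \<bar>x' r \<bullet> b\<bar> = s b * (x' r \<bullet> b))) (at_right a)"
  proof eventually_elim
    case (elim r)
    then have d: "(x has_vector_derivative x' r) (at r)" using x'_deriv vector_derivative_works by blast
    moreover have "isCont x' r" using elim(3) by (auto dest: differentiable_imp_continuous_within)
    moreover have "\<bar>x' r \<bullet> b\<bar> = s b * (x' r \<bullet> b)" if "b \<in> Basis" for b
      using elim(1) that bounded_linear.has_vector_derivative[OF bounded_linear_inner_left d, of b] by blast
    ultimately show ?case by blast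
  qed
  then show ?thesis using s by blast
qed

text \<open>\<open>H\<close> is the signed sum of the coordinates of an almost extremal curve and
  \<open>h\<close> the l1 norm of its velocity. Boundedness of the curve thus bounds the primitive
  of \<open>h\<close>, which is the integrability needed at \<open>a\<close>.\<close>

lemma nontransversal_velocity_bound:
  fixes S :: "real \<Rightarrow> 'b::euclidean_space set"
  assumes S: "definable (gph UNIV S)"
  shows "\<exists>c H h B. a < c \<and> (\<forall>r. a < r \<longrightarrow> r < c \<longrightarrow>
      (H has_real_derivative h r) (at r) \<and> isCont h r \<and> 0 \<le> h r \<and> \<bar>H r\<bar> \<le> B \<and>
      (\<forall>y\<in>S r. norm y \<le> \<rho> \<longrightarrow> (\<exists>w. norm w \<le> h r + 2 \<and> \<not> transversal (gph UNIV S) (r, y) (1, w))))"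
proof -
  let ?Q = "gph UNIV S"
  have in_gph: "(r, y) \<in> ?Q \<longleftrightarrow> y \<in> S r" for r y by (simp add: gph_def)
  \<comment> \<open>That \<open>\<mu>\<close> is bad says in first-order terms that no
    \<open>w\<close> of norm at most \<open>\<mu>\<close> is admissible at \<open>y\<close>. Almost
    maximising \<open>\<mu>\<close> over all \<open>y\<close> thus finds a worst point of the
    fibre.\<close>
  define bad where "bad r y \<mu> \<longleftrightarrow> (r, y) \<in> ?Q \<and> norm y \<le> \<rho> \<and> 0 \<le> \<mu> \<and>
      (\<forall>w. norm w \<le> \<mu> \<longrightarrow> transversal ?Q (r, y) (1, w))" for r y \<mu>
  \<comment> \<open>The second alternative caters for unbounded sets of admissible \<open>\<mu>\<close>; it would make the speed of a
    bounded curve at least \<open>1 / (r - a)\<^sup>2\<close>, and is thereby excluded near \<open>a\<close> below.\<close>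
  define X where "X = {z. bad (fst z) (snd (snd z)) (fst (snd z)) \<and>
      ((\<forall>m y. bad (fst z) y m \<longrightarrow> m \<le> fst (snd z) + 1) \<or> 1 \<le> fst (snd z) * ((fst z - a) * (fst z - a)))}"
  have "definable X"
    unfolding X_def bad_def
    by (intro definable_intros definable_vimage[OF _ S] definable_transversal S)
  from definable_choice[OF this] obtain f where f: "definable_map f"
    and fX: "\<forall>r y. (r, y) \<in> X \<longrightarrow> (r, f r) \<in> X" by blast
  define \<nu> x where "\<nu> r = fst (f r)" and "x r = snd (f r)" for r
  have \<nu>: "definable_map \<nu>" and x: "definable_map x"
    unfolding \<nu>_def x_def by (intro definable_intros f)+
  have sel: "bad r (x r) (\<nu> r)" "(\<forall>m y. bad r y m \<longrightarrow> m \<le> \<nu> r + 1) \<or> 1 \<le> \<nu> r * ((r - a) * (r - a))"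
    if r: "a < r" and ex: "\<exists>y \<mu>. bad r y \<mu>" for r
  proof -
    have "\<exists>\<mu> y. (r, (\<mu>, y)) \<in> X"
    proof (cases "bdd_above {\<mu>. \<exists>y. bad r y \<mu>}")
      case True
      have lt: "Sup {\<mu>. \<exists>y. bad r y \<mu>} - 1 < Sup {\<mu>. \<exists>y. bad r y \<mu>}" by simp
      have ne: "{\<mu>. \<exists>y. bad r y \<mu>} \<noteq> {}" using ex by blast
      obtain \<mu> where \<mu>: "\<mu> \<in> {\<mu>. \<exists>y. bad r y \<mu>}" "Sup {\<mu>. \<exists>y. bad r y \<mu>} - 1 < \<mu>"
        by (rule less_cSupE[OF lt ne]) (rule that)
      have "m \<le> \<mu> + 1" if m: "bad r y m" for m y
      proof -
        have "m \<le> Sup {\<mu>. \<exists>y. bad r y \<mu>}" using m by (intro cSup_upper True) auto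
        then show ?thesis using \<mu>(2) by linarith
      qed
      then show ?thesis using \<mu>(1) unfolding X_def by auto
    next
      case False
      then have "\<exists>\<mu>\<in>{\<mu>. \<exists>y. bad r y \<mu>}. \<not> \<mu> \<le> 1 / ((r - a) * (r - a))"
        unfolding bdd_above_def by blast
      then obtain \<mu> y where \<mu>: "bad r y \<mu>" "1 / ((r - a) * (r - a)) \<le> \<mu>"
        by (auto simp: not_le intro: less_imp_le)
      have "1 \<le> \<mu> * ((r - a) * (r - a))" using \<mu>(2) r by (simp add: divide_simps split: if_splits)
      then show ?thesis using \<mu>(1) unfolding X_def by auto
    qed
    then have "(r, f r) \<in> X" using fX by blast
    then show "bad r (x r) (\<nu> r)" "(\<forall>m y. bad r y m \<longrightarrow> m \<le> \<nu> r + 1) \<or> 1 \<le> \<nu> r * ((r - a) * (r - a))"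
      unfolding X_def \<nu>_def x_def by auto
  qed
  have "definable {r. \<exists>y \<mu>. bad r y \<mu>}"
    unfolding bad_def by (intro definable_intros definable_vimage[OF _ S] definable_transversal S)
  from definable_eventually_at_right[OF this, of a] show ?thesis
  proof
    assume "eventually (\<lambda>r. \<not> (\<exists>y \<mu>. bad r y \<mu>)) (at_right a)"
    then obtain c where c: "a < c" "\<And>r y \<mu>. a < r \<Longrightarrow> r < c \<Longrightarrow> \<not> bad r y \<mu>"
      unfolding eventually_at_right_field by blast
    \<comment> \<open>Without bad triples the level 2 in particular is not bad, so
      \<open>h = 0\<close> serves.\<close>
    have "\<exists>w. norm w \<le> 0 + 2 \<and> \<not> transversal ?Q (r, y) (1, w)"
      if "a < r" "r < c" "y \<in> S r" "norm y \<le> \<rho>" for r y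
      using c(2)[of r y 2] that unfolding bad_def in_gph by auto
    then show ?thesis
      using c(1) by (intro exI[of _ c] exI[of _ "\<lambda>_. 0"] exI[of _ 0]) auto
  next
    assume T: "eventually (\<lambda>r. \<exists>y \<mu>. bad r y \<mu>) (at_right a)"
    obtain x' s where s: "\<And>b. b \<in> Basis \<Longrightarrow> \<bar>s b\<bar> = (1::real)"
      and x': "eventually (\<lambda>r. (x has_vector_derivative x' r) (at r) \<and> isCont x' r \<and>
        (\<forall>b\<in>Basis. \<bar>x' r \<bullet> b\<bar> = s b * (x' r \<bullet> b))) (at_right a)"
      using definable_curve_derivative[OF x, of a] by blast
    have "definable_map (\<lambda>r. (r, x r))" by (intro definable_intros x)
    from finite_transversal_velocity[OF S this]
    have nt: "eventually (\<lambda>r. \<exists>g. ((\<lambda>r. (r, x r)) has_vector_derivative g) (at r) \<and> \<not> transversal ?Q (r, x r) g) (at_right a)"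
      by (auto dest!: eventually_not_in_finite[of _ a "{a<..}"])
    have "definable {r. 1 \<le> \<nu> r * ((r - a) * (r - a))}" by (intro definable_intros \<nu>)
    then have dich: "eventually (\<lambda>r. 1 \<le> \<nu> r * ((r - a) * (r - a))) (at_right a) \<or>
        eventually (\<lambda>r. \<not> 1 \<le> \<nu> r * ((r - a) * (r - a))) (at_right a)"
      by (rule definable_eventually_at_right)
    let ?H = "\<lambda>r. \<Sum>b\<in>Basis. s b * (x r \<bullet> b)" and ?h = "\<lambda>r. \<Sum>b\<in>Basis. s b * (x' r \<bullet> b)"
    let ?B = "real DIM('b) * \<rho>"
    have right: "eventually (\<lambda>r. a < r) (at_right a)" by (simp add: eventually_at_filter)
    from T x' nt right have ev: "eventually (\<lambda>r. (?H has_real_derivative ?h r) (at r) \<and> isCont ?h r \<and> 0 \<le> ?h r \<and>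
        \<bar>?H r\<bar> \<le> ?B \<and> \<nu> r < ?h r \<and>
        ((\<forall>m y. bad r y m \<longrightarrow> m \<le> \<nu> r + 1) \<or> 1 \<le> \<nu> r * ((r - a) * (r - a)))) (at_right a)"
    proof eventually_elim
      case (elim r)
      note bad = sel[OF elim(4,1)]
      have xd: "(x has_vector_derivative x' r) (at r)" using elim(2) by blast
      obtain g where g: "((\<lambda>r. (r, x r)) has_vector_derivative g) (at r)" "\<not> transversal ?Q (r, x r) g"
        using elim(3) by blast
      have "((\<lambda>r. (r, x r)) has_vector_derivative (1, x' r)) (at r)"
        by (intro has_vector_derivative_Pair has_vector_derivative_id xd)
      then have "g = (1, x' r)" using g(1) by (rule vector_derivative_unique_at[rotated])
      \<comment> \<open>The vector \<open>(1, x' r)\<close> is not transversal, whereas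
        \<open>bad\<close> makes every \<open>(1, w)\<close> with
        \<open>norm w \<le> \<nu> r\<close> transversal.\<close>
      then have "\<nu> r < norm (x' r)" using bad(1) g(2) unfolding bad_def by force
      also have "\<dots> \<le> l1_norm (x' r)" by (rule norm_le_l1)
      also have h: "\<dots> = ?h r" using elim(2) by simp
      finally have "\<nu> r < ?h r" .
      moreover have "0 \<le> ?h r" unfolding h[symmetric] by (intro sum_nonneg) auto
      moreover have "(?H has_real_derivative ?h r) (at r)"
        unfolding has_real_derivative_iff_has_vector_derivative
        by (intro has_vector_derivative_sum bounded_linear.has_vector_derivative[OF bounded_linear_mult_right]
            bounded_linear.has_vector_derivative[OF bounded_linear_inner_left] xd)
      moreover have "isCont ?h r" using elim(2) by (intro continuous_intros) auto
      moreover have "\<bar>?H r\<bar> \<le> ?B"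
      proof -
        have "\<bar>?H r\<bar> \<le> (\<Sum>b\<in>Basis. \<bar>s b * (x r \<bullet> b)\<bar>)" by (rule sum_abs)
        also have "\<dots> \<le> (\<Sum>b\<in>(Basis::'b set). \<rho>)"
        proof (rule sum_mono)
          fix b :: 'b assume "b \<in> Basis"
          then show "\<bar>s b * (x r \<bullet> b)\<bar> \<le> \<rho>"
            using s Basis_le_norm[of b "x r"] bad(1) by (simp add: abs_mult bad_def)
        qed
        finally show ?thesis by simp
      qed
      ultimately show ?case using bad(2) by blast
    qed
    show ?thesis
      using dich
    proof
      assume "eventually (\<lambda>r. 1 \<le> \<nu> r * ((r - a) * (r - a))) (at_right a)"
      with ev right have "eventually (\<lambda>r. (?H has_real_derivative ?h r) (at r) \<and> \<bar>?H r\<bar> \<le> ?B \<and>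
          1 / (r - a)\<^sup>2 \<le> ?h r) (at_right a)"
      proof eventually_elim
        case (elim r)
        then have "1 / (r - a)\<^sup>2 \<le> \<nu> r" by (simp add: power2_eq_square divide_simps)
        then show ?case using elim(1) by linarith
      qed
      then obtain c where "a < c" "\<And>r. a < r \<Longrightarrow> r < c \<Longrightarrow>
          (?H has_real_derivative ?h r) (at r) \<and> \<bar>?H r\<bar> \<le> ?B \<and> 1 / (r - a)\<^sup>2 \<le> ?h r"
        unfolding eventually_at_right_field by blast
      then have False by (intro no_bounded_primitive_of_inverse_square[of a c ?H ?h ?B]) auto
      then show ?thesis ..
    next
      assume "eventually (\<lambda>r. \<not> 1 \<le> \<nu> r * ((r - a) * (r - a))) (at_right a)"
      with ev right have "eventually (\<lambda>r. (?H has_real_derivative ?h r) (at r) \<and> isCont ?h r \<and> 0 \<le> ?h r \<and> \<bar>?H r\<bar> \<le> ?B \<and>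
          (\<forall>y\<in>S r. norm y \<le> \<rho> \<longrightarrow> (\<exists>w. norm w \<le> ?h r + 2 \<and> \<not> transversal ?Q (r, y) (1, w)))) (at_right a)"
      proof eventually_elim
        case (elim r)
        have "\<exists>w. norm w \<le> ?h r + 2 \<and> \<not> transversal ?Q (r, y) (1, w)" if y: "y \<in> S r" "norm y \<le> \<rho>" for y
        proof (rule ccontr)
          assume "\<not> ?thesis"
          \<comment> \<open>A bad level exceeds \<open>\<nu> r\<close> by at most 1, and
            \<open>\<nu> r < ?h r\<close>; hence \<open>?h r + 2\<close> cannot be bad.\<close>
          then have "bad r y (?h r + 2)" using y elim(1) unfolding bad_def in_gph by auto
          then have "?h r + 2 \<le> \<nu> r + 1" using elim(1,3) by blast
          then show False using elim(1) by linarith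
        qed
        then show ?case using elim(1) by blast
      qed
      then obtain c where "a < c" "\<forall>r. a < r \<longrightarrow> r < c \<longrightarrow>
          ((?H has_real_derivative ?h r) (at r) \<and> isCont ?h r \<and> 0 \<le> ?h r \<and> \<bar>?H r\<bar> \<le> ?B \<and>
          (\<forall>y\<in>S r. norm y \<le> \<rho> \<longrightarrow> (\<exists>w. norm w \<le> ?h r + 2 \<and> \<not> transversal ?Q (r, y) (1, w))))"
        unfolding eventually_at_right_field by blast
      then show ?thesis
        by (intro exI[of _ c], rule_tac exI[of _ ?H], rule_tac exI[of _ ?h], rule_tac exI[of _ ?B]) blast
    qed
  qed
qed

end

section \<open>The reparametrization\<close>

text \<open>\<open>\<Phi>\<close> is a primitive of \<open>h + 2\<close> and \<open>\<Psi>\<close>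
  its inverse. The bounded nondecreasing \<open>H\<close> has a finite limit at \<open>a\<close>, so
  \<open>\<Phi>\<close> extends continuously to \<open>a\<close>, even where \<open>h\<close> is
  unbounded near \<open>a\<close>.\<close>

lemma inverse_reparametrization:
  fixes H h :: "real \<Rightarrow> real"
  assumes ac: "a < c"
    and deriv: "\<And>r. a < r \<Longrightarrow> r < c \<Longrightarrow> (H has_real_derivative h r) (at r)"
    and nonneg: "\<And>r. a < r \<Longrightarrow> r < c \<Longrightarrow> 0 \<le> h r"
    and bound: "\<And>r. a < r \<Longrightarrow> r < c \<Longrightarrow> \<bar>H r\<bar> \<le> B"
  shows "\<exists>b \<Phi> \<Psi>. a < b \<and> strict_mono_on {a..<b} \<Psi> \<and> continuous_on {a..<b} \<Psi> \<and> \<Psi> a = a \<and>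
    (\<forall>r. a < r \<longrightarrow> r < b \<longrightarrow> a < \<Psi> r \<and> \<Psi> r < c \<and> \<Phi> (\<Psi> r) = r \<and>
      (\<Phi> has_real_derivative h (\<Psi> r) + 2) (at (\<Psi> r)) \<and>
      eventually (\<lambda>s. a < \<Phi> s \<and> \<Phi> s < b \<and> \<Psi> (\<Phi> s) = s) (nhds (\<Psi> r)) \<and>
      (\<Psi> has_real_derivative inverse (h (\<Psi> r) + 2)) (at r))"
proof -
  \<comment> \<open>On the compact interval from \<open>a\<close> to \<open>d\<close> the inverse of
    an injective continuous function is continuous; \<open>b\<close> will be
    \<open>\<Phi> d\<close>.\<close>
  obtain d where d: "a < d" "d < c" using dense[OF ac] by blast
  have mono: "H s \<le> H t" if st: "a < s" "s \<le> t" "t < c" for s t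
    using st(2)
  proof (rule DERIV_nonneg_imp_nondecreasing)
    fix x assume "s \<le> x" "x \<le> t"
    then show "\<exists>y. (H has_real_derivative y) (at x) \<and> 0 \<le> y"
      using st deriv[of x] nonneg[of x] by auto
  qed
  define L where "L = Inf (H ` {a<..<c})"
  have "- B \<le> H r" if "a < r" "r < c" for r using bound[OF that] by linarith
  then have bdd: "bdd_below (H ` {a<..<c})" by (auto intro!: bdd_belowI2)
  have L_le: "L \<le> H r" if "a < r" "r < c" for r
    unfolding L_def using that bdd by (auto intro!: cINF_lower)
  have lim: "(H \<longlongrightarrow> L) (at_right a)"
  proof (rule order_tendstoI)
    have r: "eventually (\<lambda>r. a < r \<and> r < c) (at_right a)"
      unfolding eventually_at_right_field using ac by auto
    fix y assume "y < L"
    with r show "eventually (\<lambda>r. y < H r) (at_right a)"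
      by (auto elim!: eventually_mono intro: less_le_trans[OF _ L_le])
  next
    fix y assume "L < y"
    moreover have "{a<..<c} \<noteq> {}" using d by auto
    ultimately obtain r0 where r0: "a < r0" "r0 < c" "H r0 < y"
      unfolding L_def using bdd by (auto simp: cINF_less_iff)
    have "eventually (\<lambda>r. a < r \<and> r < r0) (at_right a)"
      unfolding eventually_at_right_field using r0 by auto
    then show "eventually (\<lambda>r. H r < y) (at_right a)"
      by eventually_elim (use mono[of _ r0] r0 in \<open>auto intro: le_less_trans[of _ "H r0"]\<close>)
  qed
  \<comment> \<open>Subtracting the limit \<open>L\<close> of \<open>H\<close> at \<open>a\<close>
    makes \<open>a\<close> a fixed point at which \<open>\<Phi>\<close> is continuous from the
    right.\<close>
  define \<Phi> where "\<Phi> s = (if s \<le> a then a else a + 2 * (s - a) + (H s - L))" for s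
  have \<Phi>_deriv: "(\<Phi> has_real_derivative h s + 2) (at s)" if s: "a < s" "s < c" for s
  proof (rule has_field_derivative_transform_within_open)
    show "((\<lambda>s. a + 2 * (s - a) + (H s - L)) has_real_derivative h s + 2) (at s)"
      using deriv[OF s] by (auto intro!: derivative_eq_intros)
    show "open {a<..}" "s \<in> {a<..}" using s by auto
  qed (auto simp: \<Phi>_def)
  have \<Phi>_less: "\<Phi> s < \<Phi> t" if "a \<le> s" "s < t" "t < c" for s t
    using that mono[of s t] L_le[of t] by (cases "s = a") (auto simp: \<Phi>_def)
  have \<Phi>_cont: "continuous_on {a..d} \<Phi>"
    unfolding continuous_on_eq_continuous_within
  proof
    fix s assume s: "s \<in> {a..d}"
    show "continuous (at s within {a..d}) \<Phi>"
    proof (cases "s = a")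
      case True
      have "((\<lambda>s. a + 2 * (s - a) + (H s - L)) \<longlongrightarrow> a + 2 * (a - a) + (L - L)) (at_right a)"
        by (intro tendsto_intros lim)
      moreover have "eventually (\<lambda>s. a + 2 * (s - a) + (H s - L) = \<Phi> s) (at_right a)"
        by (simp add: \<Phi>_def eventually_at_filter)
      ultimately have "(\<Phi> \<longlongrightarrow> a) (at_right a)" by (simp add: Lim_transform_eventually)
      then show ?thesis using True d by (simp add: continuous_within at_within_Icc_at_right \<Phi>_def)
    next
      case False
      then have "isCont \<Phi> s" using s d by (intro DERIV_isCont[OF \<Phi>_deriv]) auto
      then show ?thesis by (rule continuous_at_imp_continuous_at_within)
    qed
  qed
  have inj: "inj_on \<Phi> {a..d}"
    by (rule linorder_inj_onI') (use \<Phi>_less d in fastforce)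
  define \<Psi> where "\<Psi> = the_inv_into {a..d} \<Phi>"
  define b where "b = \<Phi> d"
  have \<Phi>a: "\<Phi> a = a" by (simp add: \<Phi>_def)
  have ab: "a < b" using \<Phi>_less[of a d] d \<Phi>a by (simp add: b_def)
  have \<Psi>\<Phi>: "\<Psi> (\<Phi> s) = s" if "a \<le> s" "s \<le> d" for s
    unfolding \<Psi>_def using that by (intro the_inv_into_f_f inj) auto
  have image: "{a..b} = \<Phi> ` {a..d}"
  proof
    show "{a..b} \<subseteq> \<Phi> ` {a..d}"
    proof
      fix r assume "r \<in> {a..b}"
      then have "\<exists>s\<ge>a. s \<le> d \<and> \<Phi> s = r"
        using d \<Phi>a by (intro IVT') (auto simp: b_def \<Phi>_cont)
      then show "r \<in> \<Phi> ` {a..d}" by auto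
    qed
    have "a \<le> \<Phi> s" "\<Phi> s \<le> b" if "a \<le> s" "s \<le> d" for s
      using \<Phi>_less[of a s] \<Phi>_less[of s d] that d \<Phi>a
      by (cases "s = a"; cases "s = d"; simp add: b_def less_imp_le)+
    then show "\<Phi> ` {a..d} \<subseteq> {a..b}" by auto
  qed
  have \<Psi>: "a \<le> \<Psi> r" "\<Psi> r \<le> d" "\<Phi> (\<Psi> r) = r" if "a \<le> r" "r \<le> b" for r
  proof -
    have "r \<in> \<Phi> ` {a..d}" using that image by auto
    then obtain s where "a \<le> s" "s \<le> d" "\<Phi> s = r" by auto
    then show "a \<le> \<Psi> r" "\<Psi> r \<le> d" "\<Phi> (\<Psi> r) = r" using \<Psi>\<Phi> by auto
  qed
  have \<Psi>_strict: "a < \<Psi> r" "\<Psi> r < d" if "a < r" "r < b" for r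
    using \<Psi>[of r] that \<Phi>a by (auto simp: b_def order_less_le)
  have \<Psi>_less: "\<Psi> r < \<Psi> t" if "a \<le> r" "r < t" "t \<le> b" for r t
  proof (rule ccontr)
    assume "\<not> \<Psi> r < \<Psi> t"
    then have "\<Phi> (\<Psi> t) \<le> \<Phi> (\<Psi> r)"
      using \<Phi>_less[of "\<Psi> t" "\<Psi> r"] \<Psi>[of r] \<Psi>[of t] that d by (cases "\<Psi> t = \<Psi> r") auto
    then show False using \<Psi>(3)[of r] \<Psi>(3)[of t] that by auto
  qed
  have \<Psi>_cont: "continuous_on {a..b} \<Psi>"
    unfolding image using \<Psi>\<Phi> by (intro continuous_on_inv \<Phi>_cont) auto
  have "a < \<Psi> r \<and> \<Psi> r < c \<and> \<Phi> (\<Psi> r) = r \<and> (\<Phi> has_real_derivative h (\<Psi> r) + 2) (at (\<Psi> r)) \<and>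
      eventually (\<lambda>s. a < \<Phi> s \<and> \<Phi> s < b \<and> \<Psi> (\<Phi> s) = s) (nhds (\<Psi> r)) \<and>
      (\<Psi> has_real_derivative inverse (h (\<Psi> r) + 2)) (at r)" if r: "a < r" "r < b" for r
  proof (intro conjI)
    show 1: "a < \<Psi> r" "\<Psi> r < c" using \<Psi>_strict[OF r] d by auto
    show 2: "\<Phi> (\<Psi> r) = r" using \<Psi>(3) r by auto
    show 3: "(\<Phi> has_real_derivative h (\<Psi> r) + 2) (at (\<Psi> r))" by (rule \<Phi>_deriv[OF 1])
    have "eventually (\<lambda>s. s \<in> {a<..<d}) (nhds (\<Psi> r))"
      using \<Psi>_strict[OF r] by (intro eventually_nhds_in_open) auto
    then show "eventually (\<lambda>s. a < \<Phi> s \<and> \<Phi> s < b \<and> \<Psi> (\<Phi> s) = s) (nhds (\<Psi> r))"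
      by eventually_elim (use \<Phi>_less[of a] \<Phi>_less[of _ d] \<Psi>\<Phi> \<Phi>a d in \<open>auto simp: b_def\<close>)
    have "isCont \<Psi> r"
      using continuous_on_interior[OF \<Psi>_cont, of r] r by simp
    moreover have "h (\<Psi> r) + 2 \<noteq> 0" using nonneg[OF 1] by linarith
    ultimately show "(\<Psi> has_real_derivative inverse (h (\<Psi> r) + 2)) (at r)"
      using r \<Psi>(3) by (intro DERIV_inverse_function[where f = \<Phi> and g = \<Psi> and a = a and b = b] 3) auto
  qed
  moreover have "strict_mono_on {a..<b} \<Psi>"
    by (rule strict_mono_onI) (use \<Psi>_less in auto)
  moreover have "continuous_on {a..<b} \<Psi>"
    by (rule continuous_on_subset[OF \<Psi>_cont]) auto
  moreover have "\<Psi> a = a" using \<Psi>\<Phi>[of a] \<Phi>a d by simp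
  ultimately show ?thesis using ab by blast
qed

text \<open>Near \<open>(s, x)\<close> the map \<open>(t, y) \<mapsto> (\<Phi> t, y)\<close> carries
  the graph of \<open>S\<close> into that of \<open>S \<circ> \<Psi>\<close>. Normals are pulled
  back by the adjoint of its derivative, which multiplies the first component by
  \<open>D\<close>.\<close>

lemma epsilon_normal_reparametrize:
  fixes S :: "real \<Rightarrow> 'b::euclidean_space set"
  assumes v: "epsilon_normal (gph I (S \<circ> \<Psi>)) (\<Phi> s, x) (v1, v2)"
    and \<Phi>: "(\<Phi> has_real_derivative D) (at s)"
    and inv: "eventually (\<lambda>s. \<Phi> s \<in> I \<and> \<Psi> (\<Phi> s) = s) (nhds s)"
  shows "epsilon_normal (gph UNIV S) (s, x) (v1 * D, v2)"
  unfolding epsilon_normal_def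
proof (intro allI impI)
  fix c :: real assume c: "0 < c"
  \<comment> \<open>Half of the error \<open>c\<close> is spent on the normal inequality, stretched
    by the factor \<open>\<bar>D\<bar> + 2\<close> that bounds how the map expands distances from
    \<open>(s, x)\<close>.\<close>
  define c1 where "c1 = c / (2 * (\<bar>D\<bar> + 2))"
  \<comment> \<open>The other half of \<open>c\<close> covers \<open>v1\<close> times the
    linearisation error of \<open>\<Phi>\<close>. The bound 1 on \<open>c2\<close> is what yields
    the factor \<open>\<bar>D\<bar> + 2\<close> above.\<close>
  define c2 where "c2 = min 1 (c / (2 * (\<bar>v1\<bar> + 1)))"
  have c1: "0 < c1" "c1 * (\<bar>D\<bar> + 2) = c / 2" unfolding c1_def using c by (auto simp: field_simps add_nonneg_pos)
  have c2: "0 < c2" "c2 \<le> 1" unfolding c2_def using c by (auto simp: add_nonneg_pos)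
  have "\<bar>v1\<bar> * c2 \<le> \<bar>v1\<bar> * (c / (2 * (\<bar>v1\<bar> + 1)))" unfolding c2_def by (intro mult_left_mono) auto
  also have "\<dots> \<le> c / 2" using c by (simp add: field_simps add_nonneg_pos)
  finally have c2': "\<bar>v1\<bar> * c2 \<le> c / 2" .
  obtain h1 where h1: "0 < h1" "\<And>q. q \<in> gph I (S \<circ> \<Psi>) \<Longrightarrow> norm (q - (\<Phi> s, x)) < h1 \<Longrightarrow>
      (v1, v2) \<bullet> (q - (\<Phi> s, x)) \<le> c1 * norm (q - (\<Phi> s, x))"
    using v c1(1) unfolding epsilon_normal_def by meson
  obtain h2 where h2: "0 < h2" "\<And>t. dist t s < h2 \<Longrightarrow> \<Phi> t \<in> I \<and> \<Psi> (\<Phi> t) = t"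
    using inv unfolding eventually_nhds_metric by blast
  obtain h3 where h3: "0 < h3" "\<And>t. norm (t - s) < h3 \<Longrightarrow> norm (\<Phi> t - \<Phi> s - D * (t - s)) \<le> c2 * norm (t - s)"
    using \<Phi> c2(1) unfolding has_field_derivative_def has_derivative_at_alt by meson
  define h where "h = min (h1 / (\<bar>D\<bar> + 2)) (min h2 h3)"
  have h: "0 < h" unfolding h_def using h1(1) h2(1) h3(1) by (auto simp: add_nonneg_pos)
  have "(v1 * D, v2) \<bullet> (q - (s, x)) \<le> c * norm (q - (s, x))"
    if q: "q \<in> gph UNIV S" "norm (q - (s, x)) < h" for q
  proof -
    obtain t y where ty: "q = (t, y)" by (cases q)
    define n where "n = norm (q - (s, x))"
    have n: "\<bar>t - s\<bar> \<le> n" "norm (y - x) \<le> n" "n < h"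
      using q(2) norm_fst_le[of "q - (s, x)"] norm_snd_le[of "q - (s, x)"] by (auto simp: n_def ty norm_Pair)
    have t2: "\<Phi> t \<in> I" "\<Psi> (\<Phi> t) = t" using h2(2)[of t] n by (auto simp: h_def dist_real_def)
    define R where "R = \<Phi> t - \<Phi> s - D * (t - s)"
    have R: "\<bar>R\<bar> \<le> c2 * \<bar>t - s\<bar>" using h3(2)[of t] n by (auto simp: h_def R_def)
    then have R1: "\<bar>R\<bar> \<le> \<bar>t - s\<bar>" using c2(2) mult_right_mono[of c2 1 "\<bar>t - s\<bar>"] by simp
    have "\<bar>\<Phi> t - \<Phi> s\<bar> \<le> \<bar>D\<bar> * \<bar>t - s\<bar> + \<bar>R\<bar>"
      unfolding R_def abs_mult[symmetric] by linarith
    also have "\<dots> \<le> (\<bar>D\<bar> + 1) * n"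
      using R1 n(1) mult_left_mono[of "\<bar>t - s\<bar>" n "\<bar>D\<bar>"] by (simp add: algebra_simps)
    finally have dPhi: "\<bar>\<Phi> t - \<Phi> s\<bar> \<le> (\<bar>D\<bar> + 1) * n" .
    have "norm ((\<Phi> t, y) - (\<Phi> s, x)) \<le> norm (\<Phi> t - \<Phi> s) + norm (y - x)"
      using norm_Pair_le[of "\<Phi> t - \<Phi> s" "y - x"] by simp
    also have "\<dots> \<le> (\<bar>D\<bar> + 2) * n" using dPhi n(2) by (simp add: algebra_simps)
    finally have N: "norm ((\<Phi> t, y) - (\<Phi> s, x)) \<le> (\<bar>D\<bar> + 2) * n" .
    have "(\<bar>D\<bar> + 2) * n < h1"
      using n(3) by (simp add: h_def field_simps add_nonneg_pos)
    then have "(v1, v2) \<bullet> ((\<Phi> t, y) - (\<Phi> s, x)) \<le> c1 * norm ((\<Phi> t, y) - (\<Phi> s, x))"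
      using N q(1) t2 by (intro h1(2)) (auto simp: gph_def ty)
    also have "\<dots> \<le> c1 * ((\<bar>D\<bar> + 2) * n)" using c1(1) N by (intro mult_left_mono) auto
    also have "\<dots> = c / 2 * n" unfolding mult.assoc[symmetric] c1(2) ..
    finally have A: "v1 * (\<Phi> t - \<Phi> s) + v2 \<bullet> (y - x) \<le> c / 2 * n" by simp
    have "- (v1 * R) \<le> \<bar>v1\<bar> * (c2 * n)"
    proof -
      have "- (v1 * R) \<le> \<bar>v1\<bar> * \<bar>R\<bar>" unfolding abs_mult[symmetric] by (rule abs_ge_minus_self)
      also have "\<dots> \<le> \<bar>v1\<bar> * (c2 * n)"
        using R n(1) c2(1) by (intro mult_left_mono) (auto intro: order_trans[OF _ mult_left_mono])
      finally show ?thesis .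
    qed
    also have "\<dots> \<le> c / 2 * n"
      using c2' n(1) mult_right_mono[OF c2', of n] by (simp add: mult.assoc)
    finally have B: "- (v1 * R) \<le> c / 2 * n" .
    have "(v1 * D, v2) \<bullet> (q - (s, x)) = v1 * (\<Phi> t - \<Phi> s) + v2 \<bullet> (y - x) - v1 * R"
      by (simp add: ty R_def algebra_simps)
    also have "\<dots> \<le> c * n" using A B by (simp add: field_simps)
    finally show ?thesis by (simp add: n_def)
  qed
  then show "\<exists>h>0. \<forall>q. q \<in> gph UNIV S \<and> norm (q - (s, x)) < h \<longrightarrow>
      (v1 * D, v2) \<bullet> (q - (s, x)) \<le> c * norm (q - (s, x))"
    using h by blast
qed

text \<open>This links sequences with the first-order notion. If \<open>w \<bullet> g\<close> were
  nonzero, \<open>w\<close> with the tolerance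
  \<open>\<bar>w \<bullet> g\<bar> / (l1_norm g + 1)\<close> would witness transversality, since the
  normals \<open>v i\<close> eventually lie within that tolerance.\<close>

lemma limit_of_normals_orthogonal:
  assumes p: "p \<longlonglongrightarrow> q" and v: "v \<longlonglongrightarrow> w"
    and normal: "eventually (\<lambda>i. p i \<in> Q \<and> epsilon_normal Q (p i) (v i)) sequentially"
    and g: "\<not> transversal Q q g"
  shows "w \<bullet> g = 0"
proof (rule ccontr)
  assume "w \<bullet> g \<noteq> 0"
  then have pos: "0 < \<bar>w \<bullet> g\<bar>" by simp
  have L: "0 \<le> l1_norm g" by (intro sum_nonneg) auto
  define \<eta> where "\<eta> = \<bar>w \<bullet> g\<bar> / (l1_norm g + 1)"
  have \<eta>: "0 < \<eta>" unfolding \<eta>_def using pos L by (intro divide_pos_pos) linarith+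
  have "\<eta> * (l1_norm g + 1) = \<bar>w \<bullet> g\<bar>" unfolding \<eta>_def using L by (simp add: add_nonneg_eq_0_iff)
  then have "\<eta> * l1_norm g < \<bar>w \<bullet> g\<bar>" using \<eta> by (simp add: distrib_left)
  moreover have "nearly_normal Q q w \<eta>"
    unfolding nearly_normal_def
  proof (intro allI impI)
    fix \<delta> :: real assume "0 < \<delta>"
    have "eventually (\<lambda>i. dist (p i) q < \<delta>) sequentially" "eventually (\<lambda>i. dist (v i) w < \<eta>) sequentially"
      using tendstoD[OF p \<open>0 < \<delta>\<close>] tendstoD[OF v \<eta>] .
    with normal have "eventually (\<lambda>i. \<exists>p. p \<in> Q \<and> norm (p - q) < \<delta> \<and> (\<exists>v. epsilon_normal Q p v \<and> norm (v - w) \<le> \<eta>)) sequentially"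
    proof eventually_elim
      case (elim i)
      then show ?case by (intro exI[of _ "p i"] conjI exI[of _ "v i"]) (auto simp: dist_norm)
    qed
    then show "\<exists>p. p \<in> Q \<and> norm (p - q) < \<delta> \<and> (\<exists>v. epsilon_normal Q p v \<and> norm (v - w) \<le> \<eta>)"
      by (simp add: eventually_sequentially) blast
  qed
  ultimately show False using g \<eta> unfolding transversal_def by blast
qed

theorem theorem5p1:
  fixes M :: "nat \<Rightarrow> real list set set"
    and S :: "real \<Rightarrow> (real ^ 'n) set"
    and U :: "(real ^ 'n) set"
    and a :: real
  assumes "o_minimal_real_field M"
    and "definable_set M (gph UNIV S)"
    and "closed (gph UNIV S)"
    and "bounded U"
  shows "\<exists>b > a. \<exists>\<Psi> :: real \<Rightarrow> real.
           strict_mono_on {a..<b} \<Psi> \<and>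
           continuous_on {a..<b} \<Psi> \<and>
           \<Psi> C1_differentiable_on {a<..<b} \<and>
           \<Psi> a = a \<and>
           (\<forall>r\<in>{a<..<b}. \<forall>x \<in> S (\<Psi> r) \<inter> U.
              outer_norm (clarke_coderivative {a..<b} (S \<circ> \<Psi>) r x) \<le> 1)"
proof -
  interpret o_minimal_real_field M by fact
  let ?Q = "gph UNIV S"
  obtain \<rho> where \<rho>: "\<And>x. x \<in> U \<Longrightarrow> norm x \<le> \<rho>" using assms(4) bounded_iff by metis
  obtain c H h B where ac: "a < c" and H: "\<And>r. a < r \<Longrightarrow> r < c \<Longrightarrow>
      (H has_real_derivative h r) (at r) \<and> isCont h r \<and> 0 \<le> h r \<and> \<bar>H r\<bar> \<le> B \<and>
      (\<forall>y\<in>S r. norm y \<le> \<rho> \<longrightarrow> (\<exists>w. norm w \<le> h r + 2 \<and> \<not> transversal ?Q (r, y) (1, w)))"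
    using nontransversal_velocity_bound[OF assms(2), of a \<rho>] by blast
  obtain b \<Phi> \<Psi> where ab: "a < b" and \<Psi>: "strict_mono_on {a..<b} \<Psi>" "continuous_on {a..<b} \<Psi>" "\<Psi> a = a"
    and \<Psi>\<Phi>: "\<And>r. a < r \<Longrightarrow> r < b \<Longrightarrow> a < \<Psi> r \<and> \<Psi> r < c \<and> \<Phi> (\<Psi> r) = r \<and>
      (\<Phi> has_real_derivative h (\<Psi> r) + 2) (at (\<Psi> r)) \<and>
      eventually (\<lambda>s. a < \<Phi> s \<and> \<Phi> s < b \<and> \<Psi> (\<Phi> s) = s) (nhds (\<Psi> r)) \<and>
      (\<Psi> has_real_derivative inverse (h (\<Psi> r) + 2)) (at r)"
    using inverse_reparametrization[OF ac, of H h B] H by blast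
  have \<Psi>_cont: "isCont \<Psi> r" and h\<Psi>_cont: "isCont (\<lambda>r. h (\<Psi> r)) r" and pos: "0 < h (\<Psi> r) + 2"
    if r: "a < r" "r < b" for r
  proof -
    show "isCont \<Psi> r" using \<Psi>\<Phi>[OF r] DERIV_isCont by blast
    then show "isCont (\<lambda>r. h (\<Psi> r)) r" using \<Psi>\<Phi>[OF r] H by (intro isCont_o2[of r \<Psi> h]) auto
    have "0 \<le> h (\<Psi> r)" using \<Psi>\<Phi>[OF r] H by blast
    then show "0 < h (\<Psi> r) + 2" by simp
  qed
  have C1: "\<Psi> C1_differentiable_on {a<..<b}"
    unfolding C1_differentiable_on_def
  proof (intro exI[of _ "\<lambda>r. inverse (h (\<Psi> r) + 2)"] conjI ballI)
    show "(\<Psi> has_vector_derivative inverse (h (\<Psi> r) + 2)) (at r)" if "r \<in> {a<..<b}" for r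
      using \<Psi>\<Phi>[of r] that by (simp add: has_real_derivative_iff_has_vector_derivative)
    show "continuous_on {a<..<b} (\<lambda>r. inverse (h (\<Psi> r) + 2))"
    proof (intro continuous_at_imp_continuous_on ballI)
      fix r assume "r \<in> {a<..<b}"
      then show "isCont (\<lambda>r. inverse (h (\<Psi> r) + 2)) r"
        using h\<Psi>_cont[of r] pos[of r] by (intro continuous_intros) auto
    qed
  qed
  have "outer_norm (clarke_coderivative {a..<b} (S \<circ> \<Psi>) r x) \<le> 1"
    if r: "a < r" "r < b" and x: "x \<in> S (\<Psi> r)" "x \<in> U" for r x
  proof -
    let ?G = "gph {a..<b} (S \<circ> \<Psi>)"
    let ?D = "h (\<Psi> r) + 2"
    obtain w where w: "norm w \<le> ?D" "\<not> transversal ?Q (\<Psi> r, x) (1, w)"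
      using H[of "\<Psi> r"] \<Psi>\<Phi>[OF r] x \<rho> by blast
    \<comment> \<open>A normal to \<open>?G\<close> at \<open>q i\<close> becomes one to
      \<open>?Q\<close> when its first component is multiplied by the derivative of
      \<open>\<Phi>\<close>. These factors tend to \<open>?D\<close> by continuity of
      \<open>h\<close> along \<open>\<Psi>\<close>, and orthogonality of the limit to
      \<open>(1, w)\<close> is orthogonality of \<open>v\<close> to \<open>(?D, w)\<close>.\<close>
    have "limiting_normal_cone ?G (r, x) \<subseteq> {v. (?D, w) \<bullet> v = 0}"
    proof
      fix v assume "v \<in> limiting_normal_cone ?G (r, x)"
      then obtain q u where q: "\<And>i. q i \<in> ?G" "q \<longlonglongrightarrow> (r, x)"
        and u: "\<And>i. u i \<in> frechet_normal_cone ?G (q i)" "u \<longlonglongrightarrow> v"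
        unfolding limiting_normal_cone_def by blast
      have q1: "(\<lambda>i. fst (q i)) \<longlonglongrightarrow> r" and q2: "(\<lambda>i. snd (q i)) \<longlonglongrightarrow> x"
        using tendsto_fst[OF q(2)] tendsto_snd[OF q(2)] by auto
      have u1: "(\<lambda>i. fst (u i)) \<longlonglongrightarrow> fst v" and u2: "(\<lambda>i. snd (u i)) \<longlonglongrightarrow> snd v"
        using tendsto_fst[OF u(2)] tendsto_snd[OF u(2)] by auto
      have "(fst v * ?D, snd v) \<bullet> (1, w) = 0"
      proof (rule limit_of_normals_orthogonal[OF _ _ _ w(2)])
        show "(\<lambda>i. (\<Psi> (fst (q i)), snd (q i))) \<longlonglongrightarrow> (\<Psi> r, x)"
          by (intro tendsto_Pair isCont_tendsto_compose[OF \<Psi>_cont[OF r] q1] q2)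
        show "(\<lambda>i. (fst (u i) * (h (\<Psi> (fst (q i))) + 2), snd (u i))) \<longlonglongrightarrow> (fst v * ?D, snd v)"
          by (intro tendsto_intros isCont_tendsto_compose[OF h\<Psi>_cont[OF r] q1] u1 u2)
        \<comment> \<open>The formulas for \<open>\<Psi>\<close> and \<open>\<Phi>\<close> hold over
          the open interval only, so a tail of the sequence is taken.\<close>
        have "eventually (\<lambda>i. a < fst (q i) \<and> fst (q i) < b) sequentially"
          using order_tendstoD[OF q1] r by (simp add: eventually_conj)
        then show "eventually (\<lambda>i. (\<Psi> (fst (q i)), snd (q i)) \<in> ?Q \<and>
            epsilon_normal ?Q (\<Psi> (fst (q i)), snd (q i)) (fst (u i) * (h (\<Psi> (fst (q i))) + 2), snd (u i))) sequentially"
        proof eventually_elim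
          case (elim i)
          then have i: "a < fst (q i)" "fst (q i) < b" by auto
          have "(\<Psi> (fst (q i)), snd (q i)) \<in> ?Q" using q(1)[of i] by (auto simp: gph_def)
          moreover have "epsilon_normal ?Q (\<Psi> (fst (q i)), snd (q i)) (fst (u i) * (h (\<Psi> (fst (q i))) + 2), snd (u i))"
          proof (rule epsilon_normal_reparametrize)
            show "epsilon_normal ?G (\<Phi> (\<Psi> (fst (q i))), snd (q i)) (fst (u i), snd (u i))"
              using frechet_normal_cone_imp_epsilon_normal[OF u(1)[of i]] \<Psi>\<Phi>[OF i] by simp
            show "(\<Phi> has_real_derivative h (\<Psi> (fst (q i))) + 2) (at (\<Psi> (fst (q i))))"
              using \<Psi>\<Phi>[OF i] by blast
            have "eventually (\<lambda>s. a < \<Phi> s \<and> \<Phi> s < b \<and> \<Psi> (\<Phi> s) = s) (nhds (\<Psi> (fst (q i))))"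
              using \<Psi>\<Phi>[OF i] by blast
            then show "eventually (\<lambda>s. \<Phi> s \<in> {a..<b} \<and> \<Psi> (\<Phi> s) = s) (nhds (\<Psi> (fst (q i))))"
              by (auto elim: eventually_mono)
          qed
          ultimately show ?case ..
        qed
      qed
      then show "v \<in> {v. (?D, w) \<bullet> v = 0}" by (simp add: inner_prod_def inner_commute mult.commute)
    qed
    then have "clarke_normal_cone ?G (r, x) \<subseteq> {v. (?D, w) \<bullet> v = 0}"
      unfolding clarke_normal_cone_def
      by (intro closure_minimal hull_minimal closed_hyperplane convex_hyperplane)
    \<comment> \<open>Orthogonality of \<open>(v, - u)\<close> to \<open>(?D, w)\<close> together
      with \<open>norm w \<le> ?D\<close> bounds \<open>\<bar>v\<bar>\<close> by
      \<open>norm u\<close>; \<open>\<Phi>\<close> was given the derivative \<open>?D\<close> for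
      this purpose.\<close>
    then have *: "\<bar>v\<bar> \<le> 1" if u: "norm u \<le> 1" and v: "v \<in> clarke_coderivative {a..<b} (S \<circ> \<Psi>) r x u" for u v
    proof -
      have "(?D, w) \<bullet> (v, - u) = 0"
        using \<open>clarke_normal_cone ?G (r, x) \<subseteq> _\<close> v unfolding clarke_coderivative_def by blast
      then have "?D * v = w \<bullet> u" by simp
      then have "?D * \<bar>v\<bar> = \<bar>w \<bullet> u\<bar>" using pos[OF r] by (metis abs_mult abs_of_pos)
      also have "\<dots> \<le> norm w * norm u" by (rule Cauchy_Schwarz_ineq2)
      also have "\<dots> \<le> ?D * 1" using u w(1) pos[OF r] by (intro mult_mono) auto
      finally show ?thesis using pos[OF r] by (simp only: mult_le_cancel_left_pos)
    qed
    show ?thesis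
      unfolding outer_norm_def
    proof (intro SUP_least)
      fix u v assume "u \<in> {u. norm u \<le> 1}" "v \<in> clarke_coderivative {a..<b} (S \<circ> \<Psi>) r x u"
      then have "\<bar>v\<bar> \<le> 1" using * by blast
      then show "ennreal \<bar>v\<bar> \<le> 1" using ennreal_leI by fastforce
    qed
  qed
  then show ?thesis using ab \<Psi> C1 by (intro exI[of _ b] conjI exI[of _ \<Psi>]) auto
qed

end
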